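(* For every integer $\lambda\ge 0$, $$B_{2\lambda+1} \equiv -16(\lambda+1)\binom{\lambda+2}{3} - 16\binom{\lambda+2}{4} - 4\binom{\lambda+1}{2} + 1 \pmod{64},$$ and for every integer $\lambda\ge 1$, $$(-1)^{\lambda} B_{2\lambda} \equiv -16\lambda\binom{\lambda+1}{3} - 16\binom{\lambda+2}{4} - 4\binom{\lambda+1}{2} + 1 \pmod{64}.$$
   Context: For each integer $n\ge 1$, let $A_n$ denote the number of different ways in which a $2n\times 2n$ chessboard can be covered with $2n^2$ dominoes such that each domino covers two adjacent squares (equivalently, the number of perfect matchings of the $2n\times 2n$ square lattice graph). Define $B_n>0$ by $A_n = 2^n B_n^2$. It is well known that $B_n$ is an integer. Binomial coefficients $\binom{a}{b}$ with integers $0\le a<b$ are $0$. *)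

theory Defs
  imports Complex_Main "HOL-Library.Disjoint_Sets" "HOL-Number_Theory.Cong"
begin

definition board :: "nat \<Rightarrow> (nat \<times> nat) set" where
  "board m = {..<m} \<times> {..<m}"

definition adjacent :: "nat \<times> nat \<Rightarrow> nat \<times> nat \<Rightarrow> bool" where
  "adjacent p q \<longleftrightarrow>
     (fst p = fst q \<and> (snd q = Suc (snd p) \<or> snd p = Suc (snd q))) \<or>
     (snd p = snd q \<and> (fst q = Suc (fst p) \<or> fst p = Suc (fst q)))"

definition dominoes :: "nat \<Rightarrow> (nat \<times> nat) set set" where
  "dominoes m = {{p, q} | p q. p \<in> board m \<and> q \<in> board m \<and> adjacent p q}"

definition domino_tilings :: "nat \<Rightarrow> (nat \<times> nat) set set set" where
  "domino_tilings m = {T. T \<subseteq> dominoes m \<and> partition_on (board m) T}"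

definition A_seq :: "nat \<Rightarrow> nat" where
  "A_seq n = card (domino_tilings (2 * n))"

text \<open>\<open>B_seq n\<close> is a real number here. It is the unique positive solution of
  \<open>A_seq n = 2 ^ n * (B_seq n)\<^sup>2\<close>; see \<open>A_seq_eq\<close>, \<open>B_seq_pos\<close> and \<open>B_seq_unique\<close>.\<close>

definition B_seq :: "nat \<Rightarrow> real" where
  "B_seq n = sqrt (real (A_seq n) / 2 ^ n)"

lemma A_seq_eq: "real (A_seq n) = 2 ^ n * (B_seq n)\<^sup>2"
  by (simp add: B_seq_def)

lemma finite_domino_tilings: "finite (domino_tilings m)"
proof -
  have "domino_tilings m \<subseteq> Pow (Pow (board m))"
    by (auto simp: domino_tilings_def dominoes_def)
  moreover have "finite (Pow (Pow (board m)))"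
    by (simp add: board_def)
  ultimately show ?thesis by (rule finite_subset)
qed

lemma A_seq_pos: "A_seq n > 0"
proof -
  define D where "D = (\<lambda>(i::nat, j::nat). {(i, 2 * j), (i, Suc (2 * j))})"
  define T where "T = D ` ({..<2 * n} \<times> {..<n})"
  have "T \<subseteq> dominoes (2 * n)"
  proof
    fix d assume "d \<in> T"
    then obtain i j where ij: "i < 2 * n" "j < n" "d = {(i, 2 * j), (i, Suc (2 * j))}"
      by (auto simp: T_def D_def)
    then show "d \<in> dominoes (2 * n)"
      unfolding dominoes_def mem_Collect_eq
      by (intro exI[of _ "(i, 2 * j)"] exI[of _ "(i, Suc (2 * j))"])
         (auto simp: board_def adjacent_def)
  qed
  moreover have "partition_on (board (2 * n)) T"
  proof (rule partition_onI)
    show "\<Union> T = board (2 * n)"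
    proof
      show "\<Union> T \<subseteq> board (2 * n)"
        by (auto simp: T_def D_def board_def)
      show "board (2 * n) \<subseteq> \<Union> T"
      proof
        fix p assume "p \<in> board (2 * n)"
        then obtain i j where p: "p = (i, j)" "i < 2 * n" "j < 2 * n"
          by (auto simp: board_def)
        have "j = 2 * (j div 2) \<or> j = Suc (2 * (j div 2))" by presburger
        then have "p \<in> D (i, j div 2)" by (auto simp: p D_def)
        moreover have "D (i, j div 2) \<in> T"
          unfolding T_def using p by (intro imageI) auto
        ultimately show "p \<in> \<Union> T" by blast
      qed
    qed
  next
    fix p q assume pq: "p \<in> T" "q \<in> T" "p \<noteq> q"
    from pq obtain i j i' j' where eq: "p = D (i, j)" "q = D (i', j')"
      by (auto simp: T_def)
    with \<open>p \<noteq> q\<close> have "i \<noteq> i' \<or> j \<noteq> j'" by auto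
    moreover have "2 * j \<noteq> Suc (2 * j')" "Suc (2 * j) \<noteq> 2 * j'" by presburger+
    ultimately show "disjnt p q"
      unfolding eq D_def disjnt_def by auto
  next
    show "{} \<notin> T" by (auto simp: T_def D_def)
  qed
  ultimately have "T \<in> domino_tilings (2 * n)"
    by (simp add: domino_tilings_def)
  then show ?thesis
    using finite_domino_tilings by (auto simp: A_seq_def card_gt_0_iff)
qed

lemma B_seq_pos: "B_seq n > 0"
  using A_seq_pos by (simp add: B_seq_def)

lemma B_seq_unique:
  assumes "b > 0" "real (A_seq n) = 2 ^ n * b\<^sup>2"
  shows "b = B_seq n"
  using assms by (simp add: B_seq_def)

end

theory Submission
  imports Defs "Jordan_Normal_Form.Char_Poly" "HOL-Computational_Algebra.Polynomial_FPS"
begin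

text \<open>
  Put \<open>N = 2 * n + 1\<close> and \<open>\<alpha> a = 2 * cos (2 * \<pi> * a / N)\<close>. The proof rests on the product
  \<open>B n = (\<Prod>1 \<le> a < b \<le> n. 4 + \<alpha> a * \<alpha> b)\<close> (\<open>B_seq_eq_pair_product\<close>). The numbers \<open>\<alpha> a\<close> are
  units in the ring of integers of a cyclotomic field, so apart from the sign of a power of
  their product, \<open>B n\<close> is \<open>\<Prod>a<b. 1 + 4 * u a * u b\<close> with \<open>u a = 1 / \<alpha> a\<close>. Modulo \<open>4 ^ 3 = 64\<close>
  only the first two elementary symmetric functions of the products \<open>u a * u b\<close> survive, and
  these are \<open>e 2\<close> and \<open>e 1 * e 3 - e 4\<close> in terms of the elementary symmetric functions \<open>e k\<close> of the
  numbers \<open>u a\<close> (\<open>prod_triangle_one_plus_four\<close>). Up to sign \<open>e k\<close> is a coefficient of the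
  polynomial with roots \<open>\<alpha> a\<close>, hence a binomial coefficient (\<open>coeff_chi\<close>, \<open>esym_inverse_alpha\<close>), and
  the two cases of the theorem are the two parities of \<open>n\<close>. The remainder is \<open>64\<close> times an
  element of \<open>\<int>[\<zeta>]\<close> for an \<open>N\<close>-th root of unity \<open>\<zeta>\<close>. It is rational because \<open>B n\<close> is
  (\<open>pair_product_rational\<close>, by Newton's identities), and a rational element of \<open>\<int>[\<zeta>]\<close> is an
  integer (\<open>root_of_unity_poly_integer\<close>).

  The product for \<open>B n\<close> comes from Kasteleyn's method. With suitable signs on the edges of the
  grid, the expansion of a Pfaffian along the cells in reading order has only nonnegative terms
  and obeys the recursion of the number of tilings (\<open>card_matchings_eq_pfaffian\<close>). The grid is
  bipartite, so this Pfaffian is up to sign the determinant of a matrix \<open>K\<close> with black rows and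
  white columns (\<open>pfaffian_bipartite\<close>). Products of sine waves diagonalise \<open>K\<close> times its transpose,
  which gives \<open>(A n)\<^sup>2 = (\<Prod>p\<le>n. \<Prod>q\<le>2 * n. 4 + \<alpha> p + \<alpha> q)\<close> (\<open>A_seq_square\<close>).
  Finally \<open>(a, b) \<mapsto> (a + b, a - b)\<close> permutes the pairs of nonzero residues modulo \<open>N\<close> that are neither
  equal nor opposite, and \<open>\<alpha> (a + b) + \<alpha> (a - b) = \<alpha> a * \<alpha> b\<close>; the equal and opposite pairs
  supply the power of two in \<open>A n = 2 ^ n * (B n)\<^sup>2\<close>.
\<close>

section \<open>Pfaffians and determinants of bipartite arrays\<close>

definition del :: "nat \<Rightarrow> 'a list \<Rightarrow> 'a list" where
  "del i xs = take i xs @ drop (Suc i) xs"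

lemma length_del [simp]: "i < length xs \<Longrightarrow> length (del i xs) = length xs - 1"
  by (simp add: del_def)

lemma del_append [simp]: "del (length ys) (ys @ x # zs) = ys @ zs"
  by (simp add: del_def)

lemma split_at_nth:
  assumes "i < length xs"
  obtains ys zs where "xs = ys @ xs ! i # zs" "i = length ys"
  using assms id_take_nth_drop[of i xs] by (metis length_take min.absorb4)

lemma set_del: "distinct xs \<Longrightarrow> i < length xs \<Longrightarrow> set (del i xs) = set xs - {xs ! i}"
  by (erule split_at_nth) (metis del_append distinct_append distinct.simps(2) set_append
    list.simps(15) Un_insert_right Diff_insert_absorb Un_iff disjoint_insert(2))

lemma distinct_del: "distinct xs \<Longrightarrow> i < length xs \<Longrightarrow> distinct (del i xs)"
  by (erule split_at_nth) (metis del_append distinct_append distinct.simps(2) disjoint_insert(2) list.simps(15))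

lemma sorted_del: "sorted xs \<Longrightarrow> i < length xs \<Longrightarrow> sorted (del i xs)"
  by (erule split_at_nth) (metis del_append sorted_append sorted_simps(2) list.set_intros(2))

lemma filter_del_pos:
  assumes "i < length xs" "P (xs ! i)"
  shows "filter P (del i xs) = del (length (filter P (take i xs))) (filter P xs)"
proof -
  obtain ys x zs where xs: "xs = ys @ x # zs" "i = length ys" "x = xs ! i"
    using assms(1) by (metis split_at_nth)
  show ?thesis using assms(2) xs(3) unfolding xs(1,2) by simp
qed

lemma filter_del_neg:
  assumes "i < length xs" "\<not> P (xs ! i)"
  shows "filter P (del i xs) = filter P xs"
proof -
  obtain ys x zs where xs: "xs = ys @ x # zs" "i = length ys" "x = xs ! i"
    using assms(1) by (metis split_at_nth)
  show ?thesis using assms(2) xs(3) unfolding xs(1,2) by simp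
qed

lemma nth_filter_take:
  assumes "i < length xs" "P (xs ! i)"
  shows "filter P xs ! length (filter P (take i xs)) = xs ! i"
    and "length (filter P (take i xs)) < length (filter P xs)"
proof -
  obtain ys x zs where xs: "xs = ys @ x # zs" "i = length ys" "x = xs ! i"
    using assms(1) by (metis split_at_nth)
  show "filter P xs ! length (filter P (take i xs)) = xs ! i"
    and "length (filter P (take i xs)) < length (filter P xs)"
    using assms(2) xs(3) unfolding xs(1,2) by (simp_all add: nth_append)
qed

lemma sum_filter_reindex:
  "(\<Sum>i<length xs. if P (xs ! i) then F (length (filter P (take i xs))) else 0) =
   (\<Sum>j<length (filter P xs). F j)"
proof (induction xs rule: rev_induct)
  case (snoc x xs)
  have "(\<Sum>i<length xs. if P ((xs @ [x]) ! i) then F (length (filter P (take i (xs @ [x])))) else 0)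
      = (\<Sum>i<length xs. if P (xs ! i) then F (length (filter P (take i xs))) else 0)"
    by (intro sum.cong) (auto simp: nth_append)
  with snoc show ?case by simp
qed simp

text \<open>
  Only the entries \<open>a x y\<close> with \<open>x\<close> before \<open>y\<close> in the list are read. For skew-symmetric \<open>a\<close> this is the
  expansion of the Pfaffian of \<open>a\<close> on the list along its first row.
\<close>

function pfaffian :: "('a \<Rightarrow> 'a \<Rightarrow> 'b :: comm_ring_1) \<Rightarrow> 'a list \<Rightarrow> 'b" where
  "pfaffian a [] = 1"
| "pfaffian a (x # xs) = (\<Sum>i<length xs. (-1) ^ i * a x (xs ! i) * pfaffian a (del i xs))"
  by pat_completeness auto
termination by (relation "measure (\<lambda>(a, xs). length xs)") auto

definition submat :: "('a \<Rightarrow> 'a \<Rightarrow> 'b) \<Rightarrow> 'a list \<Rightarrow> 'a list \<Rightarrow> 'b mat" where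
  "submat a rs cs = mat (length rs) (length cs) (\<lambda>(i, j). a (rs ! i) (cs ! j))"

lemma det_submat_Cons:
  fixes a :: "'a \<Rightarrow> 'a \<Rightarrow> 'b :: comm_ring_1"
  assumes "length cs = Suc (length rs)"
  shows "det (submat a (r # rs) cs) =
    (\<Sum>j<length cs. (-1) ^ j * a r (cs ! j) * det (submat a rs (del j cs)))"
proof -
  have "det (submat a (r # rs) cs) =
      (\<Sum>j<length cs. submat a (r # rs) cs $$ (0, j) * cofactor (submat a (r # rs) cs) 0 j)"
    by (rule laplace_expansion_row) (auto simp: submat_def assms)
  also have "\<dots> = (\<Sum>j<length cs. (-1) ^ j * a r (cs ! j) * det (submat a rs (del j cs)))"
  proof (rule sum.cong)
    fix j assume "j \<in> {..<length cs}"
    then have j: "j < length cs" by simp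
    have "mat_delete (submat a (r # rs) cs) 0 j = submat a rs (del j cs)"
      using j assms by (intro eq_matI) (auto simp: submat_def mat_delete_def del_def nth_append min_def)
    then show "submat a (r # rs) cs $$ (0, j) * cofactor (submat a (r # rs) cs) 0 j =
        (-1) ^ j * a r (cs ! j) * det (submat a rs (del j cs))"
      using j by (simp add: cofactor_def submat_def)
  qed simp
  finally show ?thesis .
qed

text \<open>
  The parity of this number is that of the shuffle that moves the elements satisfying \<open>B\<close> to the
  front of the list.
\<close>

fun inversions :: "('a \<Rightarrow> bool) \<Rightarrow> 'a list \<Rightarrow> nat" where
  "inversions B [] = 0"
| "inversions B (x # xs) = (if B x then 0 else length (filter B xs)) + inversions B xs"

lemma inversions_append:
  "inversions B (xs @ ys) = inversions B xs + inversions B ys +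
     length (filter (\<lambda>x. \<not> B x) xs) * length (filter B ys)"
  by (induction xs) auto

lemma inversions_del:
  assumes "i < length xs" "\<not> B (xs ! i)"
  shows "inversions B xs = inversions B (del i xs) + length (filter B (drop (Suc i) xs))"
proof -
  obtain ys x zs where xs: "xs = ys @ x # zs" "i = length ys" "x = xs ! i"
    using assms(1) by (metis split_at_nth)
  show ?thesis using assms(2) xs(3) unfolding xs(1,2) by (simp add: inversions_append)
qed

lemma inversions_compl:
  "inversions B xs + inversions (\<lambda>x. \<not> B x) xs =
     length (filter B xs) * length (filter (\<lambda>x. \<not> B x) xs)"
  by (induction xs) auto

lemma det_submat_swap:
  fixes a :: "'a \<Rightarrow> 'a \<Rightarrow> 'b :: comm_ring_1"
  assumes skew: "\<And>x y. a y x = - a x y" and len: "length rs = length cs"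
  shows "det (submat a cs rs) = (-1) ^ length rs * det (submat a rs cs)"
proof -
  have "submat a cs rs = (-1) \<cdot>\<^sub>m transpose_mat (submat a rs cs)"
    by (intro eq_matI) (auto simp: submat_def intro: skew)
  moreover have "det (transpose_mat (submat a rs cs)) = det (submat a rs cs)"
    by (rule det_transpose) (auto simp: submat_def len)
  ultimately show ?thesis by (simp add: submat_def len)
qed

lemma minus_one_power_eqI: "even (m + n) \<Longrightarrow> (-1 :: 'b :: ring_1) ^ m = (-1) ^ n"
  by (metis even_add neg_one_even_power neg_one_odd_power)

text \<open>
  Where \<open>a\<close> vanishes inside the two colour classes, expanding the Pfaffian along an element of colour
  \<open>B\<close> and expanding the determinant along its row produce the same terms. The signs differ by the
  shuffle that separates the colours, and by the sign \<open>(-1) ^ (k choose 2)\<close> of the Pfaffian of a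
  block matrix with zero diagonal blocks. The induction treats all colourings at once: exchanging
  the colours transposes and negates the block, so the first element may be taken to satisfy \<open>B\<close>.
\<close>

lemma pfaffian_bipartite:
  fixes a :: "'a \<Rightarrow> 'a \<Rightarrow> 'b :: comm_ring_1"
  assumes skew: "\<And>x y. a y x = - a x y"
    and bip: "\<And>x y. B x = B y \<Longrightarrow> a x y = 0"
    and len: "length (filter B xs) = k" "length (filter (\<lambda>x. \<not> B x) xs) = k"
  shows "pfaffian a xs = (-1) ^ (inversions B xs + (k choose 2)) *
           det (submat a (filter B xs) (filter (\<lambda>x. \<not> B x) xs))"
  using bip len
proof (induction xs arbitrary: B k rule: length_induct)
  case (1 xs)
  show ?case
  proof (cases xs)
    case Nil
    with 1 show ?thesis by (simp add: submat_def binomial_eq_0)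
  next
    case (Cons x xs')
    \<comment> \<open>Deleting the partner at position \<open>i\<close>: \<open>b\<close> and \<open>j\<close> count the elements of either colour before it,
      \<open>I\<close> and \<open>I'\<close> the inversions, \<open>c\<close> and \<open>c'\<close> the binomial coefficients before and after.\<close>
    have parity: "(-1 :: 'b) ^ (i + (I' + c')) = (-1) ^ (I + c + j)"
      if "I + b = I' + k'" "i = b + j" "c = k' + c'" for i j b c c' k' I I' :: nat
      using that by (intro minus_one_power_eqI) presburger
    have parity': "even (w + c + k + (b + c))" if "even (b + w + k)" for b w c k :: nat
      using that by presburger
    have regroup: "p * A * (q * D) = r * (s * A * D)" if "p * q = r * s" for p q r s A D :: 'b
    proof -
      have "p * A * (q * D) = (p * q) * (A * D)" by (simp only: ac_simps)
      also have "\<dots> = r * (s * A * D)" unfolding that by (simp only: ac_simps)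
      finally show ?thesis .
    qed
    have black: "pfaffian a xs = (-1) ^ (inversions C xs + (k choose 2)) *
           det (submat a (filter C xs) (filter (\<lambda>x. \<not> C x) xs))"
      if C: "C x" and bipC: "\<And>x y. C x = C y \<Longrightarrow> a x y = 0"
        and lenC: "length (filter C xs) = k" "length (filter (\<lambda>x. \<not> C x) xs) = k" for C
    proof -
      let ?W = "\<lambda>x. \<not> C x"
      obtain k' where k': "k = Suc k'" using C lenC Cons by (cases k) auto
      let ?bs = "filter C xs'" and ?ws = "filter ?W xs'"
      have lens: "length ?bs = k'" "length ?ws = k" using lenC C Cons k' by auto
      have len': "length ?ws = Suc (length ?bs)" using lens k' by simp
      let ?F = "\<lambda>j. (-1) ^ (inversions C xs + (k choose 2)) * ((-1) ^ j * a x (?ws ! j) * det (submat a ?bs (del j ?ws)))"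
      have "pfaffian a xs = (\<Sum>i<length xs'. if ?W (xs' ! i) then ?F (length (filter ?W (take i xs'))) else 0)"
        unfolding Cons pfaffian.simps
      proof (rule sum.cong)
        fix i assume "i \<in> {..<length xs'}"
        then have i: "i < length xs'" by simp
        show "(- 1) ^ i * a x (xs' ! i) * pfaffian a (del i xs') =
          (if ?W (xs' ! i) then (-1) ^ (inversions C (x # xs') + (k choose 2)) *
             ((- 1) ^ length (filter ?W (take i xs')) * a x (?ws ! length (filter ?W (take i xs'))) *
              det (submat a ?bs (del (length (filter ?W (take i xs'))) ?ws))) else 0)"
        proof (cases "C (xs' ! i)")
          case True
          then show ?thesis using bipC[of x "xs' ! i"] C by simp
        next
          case False
          let ?j = "length (filter ?W (take i xs'))"
          have nth: "?ws ! ?j = xs' ! i" "?j < length ?ws"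
            using nth_filter_take[of i xs' ?W] i False by auto
          have fb: "filter C (del i xs') = ?bs"
            using filter_del_neg[of i xs' C] i False by simp
          have fw: "filter ?W (del i xs') = del ?j ?ws"
            using filter_del_pos[of i xs' ?W] i False by simp
          have IH: "pfaffian a (del i xs') = (-1) ^ (inversions C (del i xs') + (k' choose 2)) *
              det (submat a ?bs (del ?j ?ws))"
            using "1.IH"[rule_format, of "del i xs'" C k'] bipC lens nth i k'
            by (simp add: fb fw Cons)
          let ?b = "length (filter C (take i xs'))"
          have "?b + length (filter C (drop (Suc i) xs')) = k'"
            using lens(1) False id_take_nth_drop[OF i]
            by (metis filter_append filter.simps(2) length_append)
          then have inv: "inversions C (x # xs') + ?b = inversions C (del i xs') + k'"
            using inversions_del[of i xs' C] i False C by simp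
          have ij: "i = ?b + ?j"
            using sum_length_filter_compl[of C "take i xs'"] i by simp
          have ch: "k choose 2 = k' + (k' choose 2)"
            by (simp add: k' numeral_2_eq_2)
          have "(- 1 :: 'b) ^ i * (-1) ^ (inversions C (del i xs') + (k' choose 2)) =
                (-1) ^ (inversions C (x # xs') + (k choose 2)) * (-1) ^ ?j"
            unfolding power_add[symmetric] using parity[OF inv ij ch] by (simp only: Cons)
          from regroup[OF this] show ?thesis using False IH nth(1) by simp
        qed
      qed simp
      also have "\<dots> = (\<Sum>j<length ?ws. ?F j)" by (rule sum_filter_reindex)
      also have "\<dots> = (-1) ^ (inversions C xs + (k choose 2)) * det (submat a (x # ?bs) ?ws)"
        unfolding det_submat_Cons[OF len'] sum_distrib_left ..
      finally show ?thesis using C Cons by simp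
    qed
    show ?thesis
    proof (cases "B x")
      case True
      then show ?thesis using black[of B] "1.prems" by blast
    next
      case False
      let ?W = "\<lambda>x. \<not> B x"
      have "pfaffian a xs = (-1) ^ (inversions ?W xs + (k choose 2)) *
           det (submat a (filter ?W xs) (filter B xs))"
        using black[of ?W] False "1.prems" by simp
      also have "det (submat a (filter ?W xs) (filter B xs)) = 
           (-1) ^ k * det (submat a (filter B xs) (filter ?W xs))"
        using det_submat_swap[of a "filter B xs" "filter ?W xs", OF skew] "1.prems"(2,3) by simp
      also have "(-1) ^ (inversions ?W xs + (k choose 2)) * ((-1) ^ k * det (submat a (filter B xs) (filter ?W xs))) =
          (-1) ^ (inversions ?W xs + (k choose 2) + k) * det (submat a (filter B xs) (filter ?W xs))"
        by (simp add: power_add mult.assoc)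
      also have "(-1 :: 'b) ^ (inversions ?W xs + (k choose 2) + k) = (-1) ^ (inversions B xs + (k choose 2))"
      proof -
        have "inversions B xs + inversions ?W xs = k * k"
          using inversions_compl[of B xs] "1.prems" by simp
        then have "even (inversions B xs + inversions ?W xs + k)" by simp
        then have "even (inversions ?W xs + (k choose 2) + k + (inversions B xs + (k choose 2)))"
          by (rule parity')
        then show ?thesis by (rule minus_one_power_eqI)
      qed
      finally show ?thesis .
    qed
  qed
qed

section \<open>Domino tilings as a signless Pfaffian expansion\<close>

definition matchings :: "('a \<Rightarrow> 'a \<Rightarrow> bool) \<Rightarrow> 'a set \<Rightarrow> 'a set set set" where
  "matchings E R = {T. T \<subseteq> {{p, q} | p q. E p q} \<and> partition_on R T}"

lemma matchings_empty [simp]: "matchings E {} = {{}}"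
  by (auto simp: matchings_def partition_on_empty)

lemma finite_matchings: "finite R \<Longrightarrow> finite (matchings E R)"
  by (rule finite_subset[of _ "Pow (Pow R)"]) (auto simp: matchings_def partition_on_def)

lemma matchings_insert:
  assumes "E x y" "x \<noteq> y" "x \<in> R" "y \<in> R" "T \<in> matchings E (R - {x, y})"
  shows "insert {x, y} T \<in> matchings E R" "{x, y} \<notin> T"
proof -
  have T: "T \<subseteq> {{p, q} | p q. E p q}" "partition_on (R - {x, y}) T"
    using assms(5) by (auto simp: matchings_def)
  have U: "\<Union> T = R - {x, y}" using T(2) by (simp add: partition_on_def)
  show "{x, y} \<notin> T" using U by blast
  have "partition_on R (insert {x, y} T)"
  proof (rule partition_onI)
    show "\<Union> (insert {x, y} T) = R" using U assms by auto
    show "{} \<notin> insert {x, y} T" using T(2) by (auto simp: partition_on_def)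
    fix p q assume "p \<in> insert {x, y} T" "q \<in> insert {x, y} T" "p \<noteq> q"
    then show "disjnt p q"
      using T(2) U disjointD[of T p q] by (auto simp: partition_on_def disjnt_def)
  qed
  with T(1) assms(1) show "insert {x, y} T \<in> matchings E R"
    by (auto simp: matchings_def)
qed

lemma matchings_remove:
  assumes sym: "\<And>p q. E p q \<Longrightarrow> E q p" and "x \<in> R" "T \<in> matchings E R"
  obtains y where "y \<in> R" "E x y" "{x, y} \<in> T" "T - {{x, y}} \<in> matchings E (R - {x, y})"
proof -
  have T: "T \<subseteq> {{p, q} | p q. E p q}" "partition_on R T"
    using assms(3) by (auto simp: matchings_def)
  have U: "\<Union> T = R" using T(2) by (simp add: partition_on_def)
  obtain d where d: "d \<in> T" "x \<in> d" using U assms(2) by blast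
  obtain p q where pq: "d = {p, q}" "E p q" using T(1) d(1) by blast
  obtain y where y: "d = {x, y}" "E x y"
    using pq d(2) sym by (cases "x = p") auto
  have "partition_on (R - {x, y}) (T - {{x, y}})"
  proof (rule partition_onI)
    show "\<Union> (T - {{x, y}}) = R - {x, y}"
    proof
      show "R - {x, y} \<subseteq> \<Union> (T - {{x, y}})" using U by blast
      have "z \<notin> {x, y}" if "e \<in> T" "e \<noteq> {x, y}" "z \<in> e" for z e
        using disjointD[of T e d] T(2) d(1) y(1) that by (auto simp: partition_on_def)
      then show "\<Union> (T - {{x, y}}) \<subseteq> R - {x, y}" using U by fastforce
    qed
    show "{} \<notin> T - {{x, y}}" using T(2) by (auto simp: partition_on_def)
    fix p q assume "p \<in> T - {{x, y}}" "q \<in> T - {{x, y}}" "p \<noteq> q"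
    then show "disjnt p q"
      using T(2) disjointD[of T p q] by (simp add: partition_on_def disjnt_def)
  qed
  then have "T - {{x, y}} \<in> matchings E (R - {x, y})"
    using T(1) by (auto simp: matchings_def)
  moreover have "y \<in> R" using U d(1) y(1) by blast
  ultimately show ?thesis using that y d(1) by blast
qed

text \<open>
  A matching of \<open>R\<close> amounts to a partner \<open>y\<close> of \<open>x\<close> together with a matching of the other elements.
\<close>

lemma card_matchings_rec:
  assumes sym: "\<And>p q. E p q \<Longrightarrow> E q p" and irr: "\<And>p. \<not> E p p"
    and "finite R" "x \<in> R"
  shows "card (matchings E R) = (\<Sum>y | y \<in> R \<and> E x y. card (matchings E (R - {x, y})))"
proof -
  let ?Y = "{y. y \<in> R \<and> E x y}"
  let ?M = "\<lambda>y. insert {x, y} ` matchings E (R - {x, y})"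
  have ne: "x \<noteq> y" if "y \<in> ?Y" for y using that irr by blast
  have sub: "?M y \<subseteq> matchings E R" if "y \<in> ?Y" for y
    using matchings_insert(1)[of E x y R] ne[OF that] that assms(4) by auto
  have "matchings E R = (\<Union>y\<in>?Y. ?M y)"
  proof
    show "(\<Union>y\<in>?Y. ?M y) \<subseteq> matchings E R"
      using sub by blast
    show "matchings E R \<subseteq> (\<Union>y\<in>?Y. ?M y)"
    proof
      fix T assume T: "T \<in> matchings E R"
      obtain y where y: "y \<in> R" "E x y" "{x, y} \<in> T" "T - {{x, y}} \<in> matchings E (R - {x, y})"
        using matchings_remove[OF sym assms(4) T] by blast
      then have "T = insert {x, y} (T - {{x, y}})" by blast
      with y show "T \<in> (\<Union>y\<in>?Y. ?M y)" by blast
    qed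
  qed
  also have "card \<dots> = (\<Sum>y\<in>?Y. card (?M y))"
  proof (rule card_UN_disjoint)
    show "finite ?Y" using assms(3) by simp
    show "\<forall>y\<in>?Y. finite (?M y)" using assms(3) by (simp add: finite_matchings)
    show "\<forall>y\<in>?Y. \<forall>z\<in>?Y. y \<noteq> z \<longrightarrow> ?M y \<inter> ?M z = {}"
    proof (intro ballI impI equals0I)
      fix y z T assume yz: "y \<in> ?Y" "z \<in> ?Y" "y \<noteq> z" and T: "T \<in> ?M y \<inter> ?M z"
      have "{x, y} \<in> T" using IntD1[OF T] by (rule imageE) simp
      moreover have "{x, z} \<in> T" using IntD2[OF T] by (rule imageE) simp
      moreover have "T \<in> matchings E R" using T sub[OF yz(1)] by auto
      ultimately have "{x, y} \<inter> {x, z} = {} \<or> {x, y} = {x, z}"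
        using disjointD[of T "{x, y}" "{x, z}"] unfolding matchings_def partition_on_def by blast
      with yz(3) show False by (auto simp: doubleton_eq_iff)
    qed
  qed
  also have "\<dots> = (\<Sum>y\<in>?Y. card (matchings E (R - {x, y})))"
  proof (rule sum.cong[OF refl])
    fix y assume y: "y \<in> ?Y"
    show "card (?M y) = card (matchings E (R - {x, y}))"
    proof (rule card_image, rule inj_onI)
      fix S T assume ST: "S \<in> matchings E (R - {x, y})" "T \<in> matchings E (R - {x, y})"
        and eq: "insert {x, y} S = insert {x, y} T"
      have "{x, y} \<notin> S" "{x, y} \<notin> T"
        using matchings_insert(2)[of E x y R] y ne[OF y] assms(4) ST by auto
      then show "S = T" using eq by (metis Diff_insert_absorb)
    qed
  qed
  finally show ?thesis .
qed

text \<open>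
  Cells are numbered row by row, so the order of the numbers is the reading order.
\<close>

definition cell :: "nat \<Rightarrow> nat \<Rightarrow> nat \<times> nat" where
  "cell m x = (x div m, x mod m)"

text \<open>
  The weight of the edge from a cell to its right or lower neighbour. When the width \<open>m\<close> is even, \<open>x\<close>
  has the parity of its column, so vertical signs alternate with the column.
\<close>

definition arc :: "nat \<Rightarrow> nat \<Rightarrow> nat \<Rightarrow> 'b :: comm_ring_1" where
  "arc m x y = (if y = x + 1 \<and> y mod m \<noteq> 0 then 1 else if y = x + m then (-1) ^ (x + 1) else 0)"

definition kasteleyn :: "nat \<Rightarrow> nat \<Rightarrow> nat \<Rightarrow> 'b :: comm_ring_1" where
  "kasteleyn m x y = arc m x y - arc m y x"

lemma inj_cell: "inj (cell m)"
  by (rule injI) (metis cell_def div_mult_mod_eq prod.inject)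

lemma adjacent_cell:
  assumes "m > 0" "x < y"
  shows "adjacent (cell m x) (cell m y) \<longleftrightarrow> (y = x + 1 \<and> y mod m \<noteq> 0) \<or> y = x + m"
proof -
  let ?i = "x div m" and ?j = "x mod m" and ?i' = "y div m" and ?j' = "y mod m"
  have x: "x = ?i * m + ?j" "?j < m" and y: "y = ?i' * m + ?j'" "?j' < m"
    using assms by simp_all
  have le: "?i \<le> ?i'" using assms by (simp add: div_le_mono)
  show ?thesis
  proof
    assume "adjacent (cell m x) (cell m y)"
    then consider "?i = ?i'" "?j' = Suc ?j" | "?j = ?j'" "?i' = Suc ?i" | "?i = ?i'" "?j = Suc ?j'"
      using le by (auto simp: adjacent_def cell_def)
    then show "(y = x + 1 \<and> y mod m \<noteq> 0) \<or> y = x + m"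
    proof cases
      case 1
      then have "y = x + 1" using x(1) y(1) by (metis add.assoc add.commute plus_1_eq_Suc)
      with 1 show ?thesis by simp
    next
      case 2
      then have "y = x + m" using x(1) y(1) by (metis add.assoc add.commute mult_Suc)
      then show ?thesis by simp
    next
      case 3
      then have "y < x" using x(1) y(1) by (metis less_add_Suc1 add_Suc_right lessI)
      then show ?thesis using assms(2) by simp
    qed
  next
    assume "(y = x + 1 \<and> y mod m \<noteq> 0) \<or> y = x + m"
    then show "adjacent (cell m x) (cell m y)"
    proof
      assume "y = x + 1 \<and> y mod m \<noteq> 0"
      then have "?j' = Suc ?j" "?i' = ?i" using assms(1)
        by (auto simp: mod_Suc div_Suc split: if_splits)
      then show ?thesis by (simp add: adjacent_def cell_def)
    next
      assume "y = x + m"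
      then show ?thesis using assms(1) by (simp add: adjacent_def cell_def)
    qed
  qed
qed

lemma adjacent_sym: "adjacent p q \<Longrightarrow> adjacent q p"
  by (auto simp: adjacent_def)

lemma not_adjacent_refl: "\<not> adjacent p p"
  by (auto simp: adjacent_def)

lemma card_matchings_Cons:
  assumes "distinct (x # xs)"
  shows "card (matchings adjacent (cell m ` set (x # xs))) =
    (\<Sum>i<length xs. if adjacent (cell m x) (cell m (xs ! i))
        then card (matchings adjacent (cell m ` set (del i xs))) else 0)"
proof -
  let ?R = "cell m ` set (x # xs)" and ?A = "\<lambda>y. adjacent (cell m x) (cell m y)"
  let ?N = "\<lambda>R. card (matchings adjacent R)"
  have "?N ?R = (\<Sum>q | q \<in> ?R \<and> adjacent (cell m x) q. ?N (?R - {cell m x, q}))"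
    by (rule card_matchings_rec) (auto simp: adjacent_sym not_adjacent_refl)
  also have "{q. q \<in> ?R \<and> adjacent (cell m x) q} = cell m ` {y \<in> set xs. ?A y}"
    by (auto simp: not_adjacent_refl)
  also have "(\<Sum>q\<in>\<dots>. ?N (?R - {cell m x, q})) = (\<Sum>y | y \<in> set xs \<and> ?A y. ?N (?R - {cell m x, cell m y}))"
    by (subst sum.reindex) (auto intro: inj_on_subset[OF inj_cell])
  also have "\<dots> = (\<Sum>y\<in>set xs. if ?A y then ?N (?R - {cell m x, cell m y}) else 0)"
    by (rule sum.inter_filter) simp
  also have "\<dots> = (\<Sum>i<length xs. if ?A (xs ! i) then ?N (?R - {cell m x, cell m (xs ! i)}) else 0)"
    by (rule sum.reindex_bij_betw[symmetric]) (use assms in \<open>auto intro: bij_betw_nth\<close>)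
  also have "\<dots> = (\<Sum>i<length xs. if ?A (xs ! i) then ?N (cell m ` set (del i xs)) else 0)"
  proof (rule sum.cong[OF refl])
    fix i assume "i \<in> {..<length xs}"
    then have "set (del i xs) = set (x # xs) - {x, xs ! i}"
      using assms by (auto simp: set_del)
    then have "?R - {cell m x, cell m (xs ! i)} = cell m ` set (del i xs)"
      by (simp add: image_set_diff[OF inj_cell])
    then show "(if ?A (xs ! i) then ?N (?R - {cell m x, cell m (xs ! i)}) else 0) =
        (if ?A (xs ! i) then ?N (cell m ` set (del i xs)) else 0)" by simp
  qed
  finally show ?thesis .
qed

text \<open>
  Removing the first cell of a region and its partner, again and again, only leads to regions that
  contain every cell at distance at least \<open>m\<close> after their first cell. In such a region the first
  cell \<open>x\<close> can only be matched to the right or down. A right neighbour is the next cell of the list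
  and enters the Pfaffian with sign \<open>1\<close>. Between \<open>x\<close> and a lower neighbour lies a number of cells whose
  parity is that of \<open>x + 1\<close>, since the region has an even number of cells; the weight of the vertical edge
  cancels this sign. So both sides satisfy the same recursion.
\<close>

lemma card_matchings_eq_pfaffian:
  assumes "even m" "m > 0"
    and "sorted_wrt (<) xs" "set xs \<subseteq> {..<m * m}" "even (length xs)"
    and "xs \<noteq> [] \<Longrightarrow> {hd xs + m..<m * m} \<subseteq> set xs"
  shows "of_nat (card (matchings adjacent (cell m ` set xs))) = (pfaffian (kasteleyn m) xs :: 'b :: comm_ring_1)"
  using assms(3-)
proof (induction xs rule: length_induct)
  case (1 xs)
  show ?case
  proof (cases xs)
    case Nil
    then show ?thesis by simp
  next
    case (Cons x ys)
    have sorted: "sorted_wrt (<) ys" "\<forall>y\<in>set ys. x < y" using "1.prems" Cons by auto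
    have sub: "set ys \<subseteq> {..<m * m}" "x < m * m" "{x + m..<m * m} \<subseteq> set ys"
      using "1.prems" Cons assms(2) by auto
    have odd: "odd (length ys)" using "1.prems" Cons by simp
    have dist: "distinct (x # ys)" using "1.prems" Cons strict_sorted_iff by blast
    have "of_nat (card (matchings adjacent (cell m ` set xs))) =
      (\<Sum>i<length ys. if adjacent (cell m x) (cell m (ys ! i))
        then of_nat (card (matchings adjacent (cell m ` set (del i ys)))) else (0 :: 'b))"
      unfolding Cons card_matchings_Cons[OF dist] of_nat_sum by (intro sum.cong) auto
    also have "\<dots> = pfaffian (kasteleyn m) xs"
      unfolding Cons pfaffian.simps
    proof (rule sum.cong[OF refl])
      fix i assume "i \<in> {..<length ys}"
      then have i: "i < length ys" by simp
      define y where "y = ys ! i"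
      have y: "x < y" "y \<in> set ys" using sorted i by (auto simp: y_def)
      have arc: "kasteleyn m x y = (arc m x y :: 'b)" using y by (simp add: kasteleyn_def arc_def)
      show "(if adjacent (cell m x) (cell m (ys ! i))
          then of_nat (card (matchings adjacent (cell m ` set (del i ys)))) else 0) =
          (-1) ^ i * kasteleyn m x (ys ! i) * (pfaffian (kasteleyn m) (del i ys) :: 'b)"
      proof (cases "adjacent (cell m x) (cell m y)")
        case False
        then have "arc m x y = (0 :: 'b)"
          using adjacent_cell[OF assms(2) y(1)] by (auto simp: arc_def)
        then show ?thesis using False arc by (simp add: y_def)
      next
        case True
        have y_cases: "(y = x + 1 \<and> y mod m \<noteq> 0) \<or> y = x + m"
          using adjacent_cell[OF assms(2) y(1)] True by simp
        have sign: "(-1) ^ i * arc m x y = (1 :: 'b)"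
        proof (cases "y = x + 1 \<and> y mod m \<noteq> 0")
          case True
          have "i = 0"
          proof (rule ccontr)
            assume "i \<noteq> 0"
            then have "ys ! 0 < y" using sorted_wrt_nth_less[OF sorted(1), of 0 i] i by (simp add: y_def)
            moreover have "x < ys ! 0" using sorted(2) i by (cases ys) auto
            ultimately show False using True by simp
          qed
          moreover have "arc m x y = (1 :: 'b)"
            unfolding arc_def using True by (rule if_P)
          ultimately show ?thesis by simp
        next
          case False
          then have ym: "y = x + m" using y_cases by blast
          have "set (drop i ys) = {y..<m * m}"
          proof (intro equalityI subsetI)
            fix z assume "z \<in> set (drop i ys)"
            then obtain k where k: "i \<le> k" "k < length ys" "z = ys ! k"
              by (auto simp: in_set_conv_nth) (metis add.commute le_add1 less_diff_conv)
            then have "y \<le> z" using sorted_wrt_nth_less[OF sorted(1), of i k]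
              by (cases "i = k") (auto simp: y_def)
            moreover have "z < m * m" using sub(1) k nth_mem by blast
            ultimately show "z \<in> {y..<m * m}" by simp
          next
            fix z assume z: "z \<in> {y..<m * m}"
            then have "z \<in> set ys" using sub(3) ym by auto
            then obtain k where k: "k < length ys" "z = ys ! k" by (auto simp: in_set_conv_nth)
            have "i \<le> k"
              using sorted_wrt_nth_less[OF sorted(1), of k i] k i z by (force simp: y_def)
            then show "z \<in> set (drop i ys)" using k
              by (metis Cons_nth_drop_Suc list.set_intros(1) set_drop_subset_set_drop subsetD)
          qed
          moreover have "distinct (drop i ys)" using dist by simp
          ultimately have "length ys - i = m * m - (x + m)"
            by (metis distinct_card length_drop card_atLeastLessThan ym)
          moreover have "x + m < m * m" using sub(1) y ym by auto
          moreover have "odd (i + x)"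
            if "l - i = M - (x + m)" "x + m < M" "i < l" "odd l" "even M" for l M
            using that assms(1) by presburger
          ultimately have "odd (i + x)" using i odd assms(1) by (metis even_mult_iff)
          then have "even (i + (x + 1))" by simp
          then have "(-1) ^ i * (-1) ^ (x + 1) = (1 :: 'b)"
            unfolding power_add[symmetric] by (rule neg_one_even_power)
          moreover have "arc m x y = ((-1) ^ (x + 1) :: 'b)"
            unfolding arc_def if_not_P[OF False] using ym by (rule if_P)
          ultimately show ?thesis by simp
        qed
        have "of_nat (card (matchings adjacent (cell m ` set (del i ys)))) = (pfaffian (kasteleyn m) (del i ys) :: 'b)"
        proof (rule "1.IH"[rule_format])
          show "length (del i ys) < length xs" using i Cons by simp
          show "sorted_wrt (<) (del i ys)"
            using sorted(1) i by (metis strict_sorted_iff sorted_del distinct_del)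
          show "set (del i ys) \<subseteq> {..<m * m}" using sub(1) dist i by (auto simp: set_del)
          show "even (length (del i ys))" using odd i by simp
          assume ne: "del i ys \<noteq> []"
          have "hd (del i ys) > x" using ne sorted(2) dist i hd_in_set[OF ne] by (simp add: set_del)
          then have "{hd (del i ys) + m..<m * m} \<subseteq> {x + m..<m * m} - {y}"
            using y_cases assms(2) by auto
          then show "{hd (del i ys) + m..<m * m} \<subseteq> set (del i ys)"
            using sub(3) dist i by (auto simp: set_del y_def)
        qed
        then show ?thesis using True arc sign by (simp add: y_def)
      qed
    qed
    finally show ?thesis .
  qed
qed

definition white :: "nat \<Rightarrow> nat \<Rightarrow> bool" where
  "white m x \<longleftrightarrow> odd (x div m + x mod m)"

lemma kasteleyn_skew: "kasteleyn m y x = - (kasteleyn m x y :: 'b :: comm_ring_1)"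
  by (simp add: kasteleyn_def)

lemma arc_bipartite:
  assumes "m > 0" "white m x = white m y"
  shows "arc m x y = 0"
  using assms by (auto simp: arc_def white_def mod_Suc div_Suc split: if_splits)

lemma kasteleyn_bipartite:
  assumes "m > 0" "white m x = white m y"
  shows "kasteleyn m x y = 0"
  using assms by (simp add: kasteleyn_def arc_bipartite)

lemma white_succ:
  assumes "even m" "m > 0"
  shows "white m (2 * y + 1) \<longleftrightarrow> \<not> white m (2 * y)"
proof -
  have "even (2 * y mod m)" using assms by (simp add: dvd_mod_iff)
  then have "Suc (2 * y mod m) \<noteq> m" using assms by (metis even_Suc)
  then show ?thesis by (simp add: white_def mod_Suc div_Suc)
qed

lemma length_filter_upt:
  assumes "\<And>y. P (2 * y + 1) \<longleftrightarrow> \<not> P (2 * y)"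
  shows "length (filter P [0..<2 * k]) = k"
  using assms by (induction k) auto

definition blacks :: "nat \<Rightarrow> nat list" where
  "blacks m = filter (\<lambda>x. \<not> white m x) [0..<m * m]"

definition whites :: "nat \<Rightarrow> nat list" where
  "whites m = filter (white m) [0..<m * m]"

lemma length_blacks_whites:
  "length (blacks (2 * n)) = 2 * n\<^sup>2" "length (whites (2 * n)) = 2 * n\<^sup>2"
proof -
  have e: "2 * n * (2 * n) = 2 * (2 * n\<^sup>2)" by (simp add: power2_eq_square)
  have w: "white (2 * n) (2 * y + 1) \<longleftrightarrow> \<not> white (2 * n) (2 * y)" if "n > 0" for y
    by (rule white_succ) (use that in auto)
  show "length (blacks (2 * n)) = 2 * n\<^sup>2"
  proof (cases "n = 0")
    case False
    then show ?thesis unfolding blacks_def e by (intro length_filter_upt) (simp only: w not_not)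
  qed (simp add: blacks_def)
  show "length (whites (2 * n)) = 2 * n\<^sup>2"
  proof (cases "n = 0")
    case False
    then show ?thesis unfolding whites_def e by (intro length_filter_upt) (simp only: w)
  qed (simp add: whites_def)
qed

lemma board_eq_cells: "cell m ` {..<m * m} = board m"
proof (intro equalityI subsetI)
  fix p assume "p \<in> cell m ` {..<m * m}"
  then show "p \<in> board m"
    by (cases "m = 0") (auto simp: cell_def board_def less_mult_imp_div_less)
next
  fix p assume "p \<in> board m"
  then obtain i j where p: "p = (i, j)" "i < m" "j < m" by (auto simp: board_def)
  have "p = cell m (i * m + j)" using p by (simp add: cell_def)
  moreover have "i * m + j < m * m"
  proof -
    have "i * m + j < Suc i * m" using p by simp
    also have "\<dots> \<le> m * m" using p by (intro mult_right_mono) auto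
    finally show ?thesis .
  qed
  ultimately show "p \<in> cell m ` {..<m * m}" by blast
qed

lemma domino_tilings_eq_matchings: "domino_tilings m = matchings adjacent (board m)"
proof -
  have "d \<in> dominoes m" if T: "T \<in> matchings adjacent (board m)" "d \<in> T" for T d
  proof -
    obtain p q where "d = {p, q}" "adjacent p q" using T unfolding matchings_def by blast
    moreover have "d \<subseteq> board m" using T by (auto simp: matchings_def partition_on_def)
    ultimately show ?thesis unfolding dominoes_def by blast
  qed
  moreover have "dominoes m \<subseteq> {{p, q} | p q. adjacent p q}"
    unfolding dominoes_def by blast
  ultimately show ?thesis unfolding domino_tilings_def matchings_def by blast
qed

lemma card_domino_tilings_eq_pfaffian:
  assumes "even m" "m > 0"
  shows "of_nat (card (domino_tilings m)) = (pfaffian (kasteleyn m) [0..<m * m] :: 'b :: comm_ring_1)"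
proof -
  have "of_nat (card (matchings adjacent (cell m ` set [0..<m * m]))) =
      (pfaffian (kasteleyn m) [0..<m * m] :: 'b)"
    by (rule card_matchings_eq_pfaffian) (use assms in auto)
  then show ?thesis
    by (simp only: domino_tilings_eq_matchings board_eq_cells[symmetric] atLeast0LessThan set_upt)
qed

text \<open>
  Squaring removes the sign that relates the Pfaffian to the determinant.
\<close>

lemma A_seq_square_eq_det:
  assumes "n > 0"
  defines "K \<equiv> submat (kasteleyn (2 * n)) (blacks (2 * n)) (whites (2 * n))"
  shows "(of_nat (A_seq n))\<^sup>2 = (det K :: 'b :: comm_ring_1)\<^sup>2"
proof -
  let ?m = "2 * n"
  have "of_nat (A_seq n) = (pfaffian (kasteleyn ?m) [0..<?m * ?m] :: 'b)"
    unfolding A_seq_def by (rule card_domino_tilings_eq_pfaffian) (use assms(1) in auto)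
  also have "\<dots> = (-1) ^ (inversions (\<lambda>x. \<not> white ?m x) [0..<?m * ?m] + (2 * n\<^sup>2 choose 2)) *
      det (submat (kasteleyn ?m) (filter (\<lambda>x. \<not> white ?m x) [0..<?m * ?m])
        (filter (\<lambda>x. \<not> \<not> white ?m x) [0..<?m * ?m]))"
  proof (rule pfaffian_bipartite)
    show "kasteleyn ?m y x = - (kasteleyn ?m x y :: 'b)" for x y by (rule kasteleyn_skew)
    show "kasteleyn ?m x y = (0 :: 'b)" if "(\<not> white ?m x) = (\<not> white ?m y)" for x y
      using that assms(1) by (intro kasteleyn_bipartite) auto
    show "length (filter (\<lambda>x. \<not> white ?m x) [0..<?m * ?m]) = 2 * n\<^sup>2"
      using length_blacks_whites(1)[of n] by (simp only: blacks_def)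
    show "length (filter (\<lambda>x. \<not> \<not> white ?m x) [0..<?m * ?m]) = 2 * n\<^sup>2"
      using length_blacks_whites(2)[of n] by (simp only: whites_def not_not)
  qed
  also have "det (submat (kasteleyn ?m) (filter (\<lambda>x. \<not> white ?m x) [0..<?m * ?m])
        (filter (\<lambda>x. \<not> \<not> white ?m x) [0..<?m * ?m])) = (det K :: 'b)"
    by (simp only: K_def blacks_def whites_def not_not)
  finally show ?thesis by (simp add: power_mult_distrib flip: power_mult)
qed

section \<open>Eigenfunctions of the Kasteleyn matrix\<close>

lemma bij_betw_div_mod:
  "bij_betw (\<lambda>(i, j). i * b + j) ({..<a} \<times> {..<b}) {..<a * b :: nat}"
proof (rule bij_betw_byWitness[where f' = "\<lambda>t. (t div b, t mod b)"])
  show "(\<lambda>(i, j). i * b + j) ` ({..<a} \<times> {..<b}) \<subseteq> {..<a * b}"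
  proof clarsimp
    fix i j assume ij: "i < a" "j < b"
    then have "i * b + j < Suc i * b" by simp
    also have "\<dots> \<le> a * b" using ij by (intro mult_right_mono) auto
    finally show "i * b + j < a * b" .
  qed
  show "(\<lambda>t. (t div b, t mod b)) ` {..<a * b} \<subseteq> {..<a} \<times> {..<b}"
    by (cases "b = 0") (auto simp: less_mult_imp_div_less)
qed auto

lemma sum_div_mod:
  fixes a b :: nat
  shows "(\<Sum>t<a * b. h (t div b) (t mod b)) = (\<Sum>i<a. \<Sum>j<b. h i j :: 'c :: comm_monoid_add)"
proof -
  have "(\<Sum>t<a * b. h (t div b) (t mod b)) =
      (\<Sum>z\<in>{..<a} \<times> {..<b}. (\<lambda>t. h (t div b) (t mod b)) ((\<lambda>(i, j). i * b + j) z))"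
    by (rule sum.reindex_bij_betw[OF bij_betw_div_mod, symmetric])
  also have "\<dots> = (\<Sum>(i, j)\<in>{..<a} \<times> {..<b}. h i j)"
    by (intro sum.cong) auto
  finally show ?thesis by (simp add: sum.cartesian_product)
qed

lemma prod_div_mod:
  fixes a b :: nat
  shows "(\<Prod>t<a * b. h (t div b) (t mod b)) = (\<Prod>i<a. \<Prod>j<b. h i j :: 'c :: comm_monoid_mult)"
proof -
  have "(\<Prod>t<a * b. h (t div b) (t mod b)) =
      (\<Prod>z\<in>{..<a} \<times> {..<b}. (\<lambda>t. h (t div b) (t mod b)) ((\<lambda>(i, j). i * b + j) z))"
    by (rule prod.reindex_bij_betw[OF bij_betw_div_mod, symmetric])
  also have "\<dots> = (\<Prod>(i, j)\<in>{..<a} \<times> {..<b}. h i j)"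
    by (intro prod.cong) auto
  finally show ?thesis by (simp add: prod.cartesian_product)
qed

lemma sum_arc_right:
  fixes f :: "nat \<Rightarrow> 'b :: comm_ring_1"
  assumes "m \<ge> 2" "x < m * m"
  shows "(\<Sum>y<m * m. arc m x y * f y) =
    (if Suc (x mod m) < m then f (x + 1) else 0) + (if x + m < m * m then (-1) ^ (x + 1) * f (x + m) else 0)"
proof -
  have iff: "Suc x mod m \<noteq> 0 \<longleftrightarrow> Suc (x mod m) < m"
  proof -
    have "x mod m < m" using assms(1) by simp
    then show ?thesis by (auto simp: mod_Suc)
  qed
  have lt: "x + 1 < m * m" if "Suc (x mod m) < m"
  proof (rule ccontr)
    assume "\<not> x + 1 < m * m"
    then have "Suc x = m * m" using assms by simp
    then have "Suc x mod m = 0" by simp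
    with iff that show False by simp
  qed
  have "arc m x y * f y = (if y = x + 1 then (if Suc (x mod m) < m then f (x + 1) else 0) else 0) +
      (if y = x + m then (-1) ^ (x + 1) * f (x + m) else 0)" for y
    using assms(1) iff by (auto simp: arc_def)
  then have "(\<Sum>y<m * m. arc m x y * f y) = 
      (\<Sum>y<m * m. if y = x + 1 then (if Suc (x mod m) < m then f (x + 1) else 0) else 0) +
      (\<Sum>y<m * m. if y = x + m then (-1) ^ (x + 1) * f (x + m) else 0)"
    by (simp add: sum.distrib)
  then show ?thesis using lt by (simp add: sum.delta)
qed

lemma sum_arc_left:
  fixes f :: "nat \<Rightarrow> 'b :: comm_ring_1"
  assumes "m \<ge> 2" "even m" "x < m * m"
  shows "(\<Sum>y<m * m. arc m y x * f y) =
    (if 0 < x mod m then f (x - 1) else 0) + (if m \<le> x then (-1) ^ (x + 1) * f (x - m) else 0)"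
proof -
  have sgn: "(-1 :: 'b) ^ (x - m) = (-1) ^ x" if "m \<le> x"
    using that assms(2) by (intro minus_one_power_eqI) simp
  have pos: "0 < x" if "0 < x mod m" using that by (cases x) auto
  have "arc m y x * f y = (if y = x - 1 then (if 0 < x mod m then f (x - 1) else 0) else 0) +
      (if y = x - m then (if m \<le> x then (-1) ^ (x + 1) * f (x - m) else 0) else 0)" for y
  proof -
    have right: "x = y + 1 \<and> x mod m \<noteq> 0 \<longleftrightarrow> y = x - 1 \<and> 0 < x mod m"
      using pos by (cases x) auto
    have down: "x = y + m \<longleftrightarrow> y = x - m \<and> m \<le> x" by arith
    consider "x = y + 1 \<and> x mod m \<noteq> 0" | "x = y + m" "\<not> (x = y + 1 \<and> x mod m \<noteq> 0)"
      | "x \<noteq> y + m" "\<not> (x = y + 1 \<and> x mod m \<noteq> 0)" by blast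
    then show ?thesis
    proof cases
      case 1
      have ny: "\<not> (y = x - m \<and> m \<le> x)" using 1 assms(1) down by linarith
      have y: "y = x - 1" "0 < x mod m" using 1 right by blast+
      show ?thesis unfolding arc_def if_P[OF 1] if_P[OF y(1)] if_P[OF y(2)] using ny y(1) by auto
    next
      case 2
      then have "y = x - m" "m \<le> x" "\<not> (y = x - 1 \<and> 0 < x mod m)" using down right by blast+
      then show ?thesis unfolding arc_def if_not_P[OF 2(2)] if_P[OF 2(1)] using sgn by simp
    next
      case 3
      then have "\<not> (y = x - m \<and> m \<le> x)" "\<not> (y = x - 1 \<and> 0 < x mod m)" using down right by blast+
      then show ?thesis unfolding arc_def if_not_P[OF 3(2)] if_not_P[OF 3(1)] by auto
    qed
  qed
  then have "(\<Sum>y<m * m. arc m y x * f y) = 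
      (\<Sum>y<m * m. if y = x - 1 then (if 0 < x mod m then f (x - 1) else 0) else 0) +
      (\<Sum>y<m * m. if y = x - m then (if m \<le> x then (-1) ^ (x + 1) * f (x - m) else 0) else 0)"
    by (simp add: sum.distrib)
  moreover have "x - 1 < m * m" "x - m < m * m" using assms(3) by auto
  ultimately show ?thesis by (simp add: sum.delta)
qed

text \<open>
  The coordinates of \<open>g\<close> start at \<open>1\<close>, which leaves room for boundary values at \<open>0\<close> and \<open>m + 1\<close>.
\<close>

definition on_board :: "nat \<Rightarrow> (nat \<Rightarrow> nat \<Rightarrow> 'b) \<Rightarrow> nat \<Rightarrow> 'b" where
  "on_board m g x = g (Suc (x div m)) (Suc (x mod m))"

text \<open>
  Since \<open>g\<close> vanishes on the frame around the board, the formula for interior cells also holds at the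
  border.
\<close>

lemma kasteleyn_apply:
  fixes g :: "nat \<Rightarrow> nat \<Rightarrow> 'b :: comm_ring_1"
  assumes m: "even m" "m > 0" and x: "x < m * m"
    and bd: "\<And>j. g 0 j = 0" "\<And>j. g (Suc m) j = 0" "\<And>i. g i 0 = 0" "\<And>i. g i (Suc m) = 0"
  defines "I \<equiv> Suc (x div m)" and "J \<equiv> Suc (x mod m)"
  shows "(\<Sum>y<m * m. kasteleyn m x y * on_board m g y) =
    g I (Suc J) - g I (J - 1) + (-1) ^ J * (g (Suc I) J - g (I - 1) J)"
proof -
  let ?f = "on_board m g" and ?i = "x div m" and ?j = "x mod m"
  have m2: "m \<ge> 2" using m by (metis One_nat_def Suc_leI even_Suc le_neq_implies_less numeral_2_eq_2 odd_one)
  have par: "even x \<longleftrightarrow> even ?j" using m(1) by (metis dvd_mod_iff)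
  have sgn: "(-1 :: 'b) ^ (x + 1) = (-1) ^ J"
    using par by (intro minus_one_power_eqI) (simp add: J_def)
  have jm: "?j < m" and im: "?i < m" using m x by (auto simp: less_mult_imp_div_less)
  have right: "(if Suc ?j < m then ?f (x + 1) else 0) = g I (Suc J)"
  proof (cases "Suc ?j < m")
    case True
    then show ?thesis by (simp add: on_board_def I_def J_def mod_Suc div_Suc)
  next
    case False
    then have "Suc J = Suc m" using jm by (simp add: J_def)
    then show ?thesis using False bd(4) by simp
  qed
  have left: "(if 0 < ?j then ?f (x - 1) else 0) = g I (J - 1)"
  proof (cases "0 < ?j")
    case True
    then obtain y where y: "x = Suc y" by (cases x) auto
    have "y mod m = ?j - 1" "y div m = ?i" using True unfolding y
      by (auto simp: mod_Suc div_Suc split: if_splits)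
    then show ?thesis using True y by (simp add: on_board_def I_def J_def)
  next
    case False
    then show ?thesis using bd(3) by (simp add: J_def)
  qed
  have down: "(if x + m < m * m then (-1) ^ (x + 1) * ?f (x + m) else 0) = (-1) ^ J * g (Suc I) J"
  proof (cases "Suc ?i < m")
    case True
    have "x + m = Suc ?i * m + ?j" by simp
    also have "\<dots> < Suc ?i * m + m" using jm by (rule add_strict_left_mono)
    also have "\<dots> = Suc (Suc ?i) * m" by simp
    also have "\<dots> \<le> m * m" using True by (intro mult_right_mono) auto
    finally show ?thesis using m(2) unfolding sgn by (simp add: on_board_def I_def J_def)
  next
    case False
    then have "?i = m - 1" "Suc I = Suc m" using im by (auto simp: I_def)
    then have "x + m = m * m + ?j"
      by (metis Suc_pred' add.commute add.left_commute div_mult_mod_eq m(2) mult_Suc)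
    then have "\<not> x + m < m * m" by simp
    then show ?thesis using \<open>Suc I = Suc m\<close> bd(2) by simp
  qed
  have up: "(if m \<le> x then (-1) ^ (x + 1) * ?f (x - m) else 0) = (-1) ^ J * g (I - 1) J"
  proof (cases "m \<le> x")
    case True
    then have "?i > 0" using m(2) by (simp add: div_greater_zero_iff)
    then show ?thesis using True m(2) unfolding sgn
      by (simp add: on_board_def I_def J_def le_div_geq le_mod_geq)
  next
    case False
    then show ?thesis using bd(1) by (simp add: I_def)
  qed
  have "(\<Sum>y<m * m. kasteleyn m x y * ?f y) = (\<Sum>y<m * m. arc m x y * ?f y) - (\<Sum>y<m * m. arc m y x * ?f y)"
    by (simp add: kasteleyn_def algebra_simps sum_subtractf)
  also have "\<dots> = (g I (Suc J) + (-1) ^ J * g (Suc I) J) - (g I (J - 1) + (-1) ^ J * g (I - 1) J)"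
    unfolding sum_arc_right[OF m2 x] sum_arc_left[OF m2 m(1) x] right left up down ..
  finally show ?thesis by (simp add: algebra_simps)
qed

text \<open>
  The waves are the eigenvectors of the path with vertices \<open>1, \<dots>, N - 1\<close>; they vanish at \<open>0\<close> and \<open>N\<close>.
\<close>

definition wave :: "nat \<Rightarrow> nat \<Rightarrow> nat \<Rightarrow> real" where
  "wave N p i = sin (real p * pi * real i / real N)"

definition eigval :: "nat \<Rightarrow> nat \<Rightarrow> real" where
  "eigval N p = 2 * cos (real p * pi / real N)"

lemma wave_boundary [simp]: "wave N p 0 = 0" "wave N p N = 0"
  by (cases "N = 0"; simp add: wave_def sin_npi)+

lemma wave_rec: "wave N p (Suc (Suc i)) + wave N p i = eigval N p * wave N p (Suc i)"
proof -
  define t where "t = real p * pi / real N"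
  have "wave N p k = sin (real k * t)" for k by (simp add: wave_def t_def mult_ac)
  moreover have "real (Suc (Suc i)) * t = real (Suc i) * t + t" "real i * t = real (Suc i) * t - t"
    by (simp_all add: algebra_simps)
  ultimately show ?thesis
    by (simp only: sin_add sin_diff eigval_def t_def[symmetric]) (simp add: algebra_simps)
qed

text \<open>
  The factor \<open>\<i> ^ (i + j)\<close> turns the differences made by skew-symmetric weights into the sums of
  \<open>wave_rec\<close>.
\<close>

definition mode :: "nat \<Rightarrow> nat \<Rightarrow> nat \<Rightarrow> nat \<Rightarrow> nat \<Rightarrow> complex" where
  "mode N p q i j = \<i> ^ (i + j) * of_real (wave N p i * wave N q j)"

lemma mode_boundary [simp]:
  "mode N p q 0 j = 0" "mode N p q N j = 0" "mode N p q i 0 = 0" "mode N p q i N = 0"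
  by (simp_all add: mode_def)

lemma mode_diff_right:
  "mode N p q i (Suc (Suc j)) - mode N p q i j = \<i> * eigval N q * mode N p q i (Suc j)"
proof -
  have "mode N p q i (Suc (Suc j)) - mode N p q i j =
      - (\<i> ^ (i + j)) * of_real (wave N p i * (wave N q (Suc (Suc j)) + wave N q j))"
    by (simp add: mode_def algebra_simps)
  also have "\<dots> = (\<i> * \<i>) * (\<i> ^ (i + j) * of_real (wave N p i * (eigval N q * wave N q (Suc j))))"
    unfolding wave_rec by simp
  also have "\<dots> = \<i> * eigval N q * mode N p q i (Suc j)"
    by (simp only: mode_def of_real_mult add_Suc_right power_Suc mult_ac)
  finally show ?thesis .
qed

lemma mode_diff_down:
  "mode N p q (Suc (Suc i)) j - mode N p q i j = \<i> * eigval N p * mode N p q (Suc i) j"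
proof -
  have "mode N p q (Suc (Suc i)) j - mode N p q i j =
      - (\<i> ^ (i + j)) * of_real ((wave N p (Suc (Suc i)) + wave N p i) * wave N q j)"
    by (simp add: mode_def algebra_simps)
  also have "\<dots> = (\<i> * \<i>) * (\<i> ^ (i + j) * of_real ((eigval N p * wave N p (Suc i)) * wave N q j))"
    unfolding wave_rec by simp
  also have "\<dots> = \<i> * eigval N p * mode N p q (Suc i) j"
    by (simp only: mode_def of_real_mult add_Suc power_Suc mult_ac)
  finally show ?thesis .
qed

text \<open>
  A mode is not an eigenvector, because vertical weights alternate with the column. A horizontal step
  changes the parity of the column, so the mixed terms cancel when the matrix is applied twice.
\<close>

lemma kasteleyn_apply_mode:
  fixes m p q x :: nat and F F' :: "nat \<Rightarrow> complex" and a b :: complex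
  assumes m: "even m" "m > 0" and x: "x < m * m"
  defines "a \<equiv> of_real (eigval (Suc m) p)" and "b \<equiv> of_real (eigval (Suc m) q)"
  defines "F \<equiv> on_board m (mode (Suc m) p q)"
  defines "F' \<equiv> on_board m (\<lambda>i j. \<i> * (b + (-1) ^ j * a) * mode (Suc m) p q i j)"
  shows "(\<Sum>y<m * m. kasteleyn m x y * F y) = F' x"
    and "(\<Sum>y<m * m. kasteleyn m x y * F' y) = - (a\<^sup>2 + b\<^sup>2) * F x"
proof -
  let ?i = "x div m" and ?j = "x mod m"
  let ?g = "mode (Suc m) p q"
  have "(\<Sum>y<m * m. kasteleyn m x y * F y) =
     (?g (Suc ?i) (Suc (Suc ?j)) - ?g (Suc ?i) ?j) + (-1) ^ Suc ?j * (?g (Suc (Suc ?i)) (Suc ?j) - ?g ?i (Suc ?j))"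
    unfolding F_def by (subst kasteleyn_apply[OF m x]) auto
  also have "\<dots> = F' x"
    unfolding mode_diff_right mode_diff_down a_def[symmetric] b_def[symmetric] by (simp add: F'_def on_board_def algebra_simps)
  finally show "(\<Sum>y<m * m. kasteleyn m x y * F y) = F' x" .
  define e :: complex where "e = (-1) ^ Suc ?j"
  have e2: "e * e = 1" by (simp add: e_def flip: power_add)
  have "(\<Sum>y<m * m. kasteleyn m x y * F' y) =
     \<i> * (b - e * a) * (?g (Suc ?i) (Suc (Suc ?j)) - ?g (Suc ?i) ?j) +
     e * (\<i> * (b + e * a)) * (?g (Suc (Suc ?i)) (Suc ?j) - ?g ?i (Suc ?j))"
    unfolding F'_def by (subst kasteleyn_apply[OF m x]) (auto simp: e_def algebra_simps)
  also have "\<dots> = - (b * b + (e * e) * (a * a)) * ?g (Suc ?i) (Suc ?j)"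
    unfolding mode_diff_right mode_diff_down a_def[symmetric] b_def[symmetric] by (simp add: algebra_simps)
  finally show "(\<Sum>y<m * m. kasteleyn m x y * F' y) = - (a\<^sup>2 + b\<^sup>2) * F x"
    unfolding e2 by (simp add: F_def on_board_def power2_eq_square add.commute)
qed

text \<open>
  Summation by parts: the factor \<open>a - b\<close> times the sum telescopes to boundary values, which vanish.
\<close>

lemma dirichlet_orthogonal:
  fixes u v :: "nat \<Rightarrow> real"
  assumes "u 0 = 0" "u (Suc m) = 0" "v 0 = 0" "v (Suc m) = 0"
    and u: "\<And>i. u (Suc (Suc i)) + u i = a * u (Suc i)"
    and v: "\<And>i. v (Suc (Suc i)) + v i = b * v (Suc i)"
    and "a \<noteq> b"
  shows "(\<Sum>i<m. u (Suc i) * v (Suc i)) = 0"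
proof -
  have "(a - b) * (u (Suc i) * v (Suc i)) =
      (u (Suc (Suc i)) * v (Suc i) - u (Suc i) * v i) - (u (Suc i) * v (Suc (Suc i)) - u i * v (Suc i))" for i
  proof -
    have "(a - b) * (u (Suc i) * v (Suc i)) = (a * u (Suc i)) * v (Suc i) - u (Suc i) * (b * v (Suc i))"
      by (simp add: algebra_simps)
    also have "\<dots> = (u (Suc (Suc i)) + u i) * v (Suc i) - u (Suc i) * (v (Suc (Suc i)) + v i)"
      by (simp only: u v)
    finally show ?thesis by (simp add: algebra_simps)
  qed
  then have "(a - b) * (\<Sum>i<m. u (Suc i) * v (Suc i)) =
      (\<Sum>i<m. u (Suc (Suc i)) * v (Suc i) - u (Suc i) * v i) -
      (\<Sum>i<m. u (Suc i) * v (Suc (Suc i)) - u i * v (Suc i))"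
    by (simp add: sum_distrib_left sum_subtractf)
  also have "\<dots> = 0"
    using sum_lessThan_telescope[of "\<lambda>i. u (Suc i) * v i" m] sum_lessThan_telescope[of "\<lambda>i. u i * v (Suc i)" m] assms(1-4)
    by simp
  finally show ?thesis using assms(7) by simp
qed

lemma eigval_inj:
  assumes "p < N" "p' < N" "p \<noteq> p'"
  shows "eigval N p \<noteq> eigval N p'"
proof
  assume eq: "eigval N p = eigval N p'"
  have "real p * pi / real N = real p' * pi / real N"
  proof (rule cos_inj_pi)
    have "real q * pi / real N \<le> pi" if "q < N" for q
      using that mult_right_mono[of "real q" "real N" pi] by (simp add: divide_le_eq mult.commute)
    then show "real p * pi / real N \<le> pi" "real p' * pi / real N \<le> pi" using assms by blast+
  qed (use eq in \<open>simp_all add: eigval_def\<close>)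
  then show False using assms by simp
qed

lemma eigval_pos:
  assumes "2 * p < N"
  shows "eigval N p > 0"
  unfolding eigval_def using assms
  by (intro mult_pos_pos cos_gt_zero_pi) (auto simp: field_simps intro: less_le_trans[of _ 0] simp flip: of_nat_mult)

lemma wave_norm_pos:
  assumes "0 < p" "p < Suc m" "m > 0"
  shows "(\<Sum>i<m. wave (Suc m) p (Suc i) * wave (Suc m) p (Suc i)) > 0"
proof (rule sum_pos2[of _ 0])
  have "wave (Suc m) p 1 > 0"
    unfolding wave_def using assms mult_strict_right_mono[of "real p" "real (Suc m)" pi]
    by (intro sin_gt_zero) (simp_all add: divide_less_eq algebra_simps)
  then show "wave (Suc m) p (Suc 0) * wave (Suc m) p (Suc 0) > 0" by simp
qed (use assms in auto)

lemma wave_orthogonal: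
  assumes "p < Suc m" "p' < Suc m" "p \<noteq> p'"
  shows "(\<Sum>i<m. wave (Suc m) p (Suc i) * wave (Suc m) p' (Suc i)) = 0"
  by (rule dirichlet_orthogonal[where a = "eigval (Suc m) p" and b = "eigval (Suc m) p'"])
     (use assms eigval_inj[of p "Suc m" p'] in \<open>auto simp: wave_rec\<close>)

text \<open>
  Multiplying a wave by \<open>(-1) ^ i\<close> negates its eigenvalue, and both eigenvalues are positive in the
  lower half of the spectrum.
\<close>

lemma wave_orthogonal_alternating:
  assumes "2 * p < Suc m" "2 * p' < Suc m"
  shows "(\<Sum>i<m. (-1) ^ Suc i * (wave (Suc m) p (Suc i) * wave (Suc m) p' (Suc i))) = 0"
proof -
  have "(\<Sum>i<m. wave (Suc m) p (Suc i) * ((-1) ^ Suc i * wave (Suc m) p' (Suc i))) = 0"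
  proof (rule dirichlet_orthogonal[where a = "eigval (Suc m) p" and b = "- eigval (Suc m) p'"])
    show "(-1) ^ Suc (Suc i) * wave (Suc m) p' (Suc (Suc i)) + (-1) ^ i * wave (Suc m) p' i =
        - eigval (Suc m) p' * ((-1) ^ Suc i * wave (Suc m) p' (Suc i))" for i
      using wave_rec[of "Suc m" p' i] by (simp flip: distrib_left)
    show "eigval (Suc m) p \<noteq> - eigval (Suc m) p'"
      using eigval_pos[OF assms(1)] eigval_pos[OF assms(2)] by linarith
  qed (auto simp: wave_rec)
  then show ?thesis by (simp add: mult.left_commute)
qed

section \<open>Kasteleyn's product formula\<close>

lemma sum_nth_filter_upt:
  fixes f :: "nat \<Rightarrow> 'b :: comm_monoid_add"
  shows "(\<Sum>c<length (filter P [0..<M]). f (filter P [0..<M] ! c)) = (\<Sum>y<M. if P y then f y else 0)"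
proof -
  have "(\<Sum>c<length (filter P [0..<M]). f (filter P [0..<M] ! c)) = sum_list (map f (filter P [0..<M]))"
    by (simp add: sum_list_sum_nth atLeast0LessThan)
  also have "\<dots> = (\<Sum>y<M. if P y then f y else 0)"
    by (simp add: sum_list_map_filter' interv_sum_list_conv_sum_set_nat atLeast0LessThan)
  finally show ?thesis .
qed

lemma mult_mat_mat:
  fixes f g :: "nat \<times> nat \<Rightarrow> 'b :: comm_semiring_0"
  shows "mat a b f * mat b c g = mat a c (\<lambda>(i, j). \<Sum>k<b. f (i, k) * g (k, j))"
  by (rule eq_matI) (auto simp: scalar_prod_def atLeast0LessThan)

lemma det_mat_diag:
  fixes f :: "nat \<Rightarrow> 'b :: comm_ring_1"
  shows "det (mat k k (\<lambda>(i, j). if i = j then f i else 0)) = (\<Prod>i<k. f i)"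
  by (subst det_upper_triangular[of _ k]) (auto simp: prod_list_diag_prod atLeast0LessThan)

lemma mode_mult_mode:
  assumes "even (i + j)"
  shows "mode N p q i j * mode N p' q' i j = of_real ((wave N p i * wave N p' i) * (wave N q j * wave N q' j))"
proof -
  have "\<i> ^ (i + j) * \<i> ^ (i + j) = ((-1) ^ (i + j) :: complex)"
    by (simp flip: power_mult_distrib)
  then have "\<i> ^ (i + j) * \<i> ^ (i + j) = (1 :: complex)" using assms by simp
  then show ?thesis by (simp add: mode_def mult_ac)
qed

text \<open>
  On black cells the powers of \<open>\<i>\<close> in the two modes multiply to \<open>1\<close>, so the sum over black cells is
  half the sum of a plain and an alternating inner product on the whole board. The alternating one
  vanishes for vertical frequencies in the lower half, which leaves as many pairwise orthogonal
  modes as there are black cells.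
\<close>

lemma black_mode_inner:
  assumes "2 * p < Suc m" "2 * p' < Suc m" "q < Suc m" "q' < Suc m" "m > 0" "p > 0" "q > 0"
  defines "s \<equiv> (\<Sum>y<m * m. if \<not> white m y then
       on_board m (mode (Suc m) p q) y * on_board m (mode (Suc m) p' q') y else 0)"
  shows "(p, q) \<noteq> (p', q') \<Longrightarrow> s = 0" "(p, q) = (p', q') \<Longrightarrow> s \<noteq> 0"
proof -
  let ?a = "\<lambda>i. wave (Suc m) p (Suc i) * wave (Suc m) p' (Suc i)"
  let ?b = "\<lambda>j. wave (Suc m) q (Suc j) * wave (Suc m) q' (Suc j)"
  have "s = (\<Sum>y<m * m. of_real ((?a (y div m) * ?b (y mod m) +
      (-1) ^ Suc (y div m) * ?a (y div m) * ((-1) ^ Suc (y mod m) * ?b (y mod m))) / 2))"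
    unfolding s_def
  proof (rule sum.cong[OF refl])
    fix y
    let ?i = "y div m" and ?j = "y mod m"
    have e: "(-1) ^ Suc ?i * ?a ?i * ((-1) ^ Suc ?j * ?b ?j) = (-1) ^ (?i + ?j) * (?a ?i * ?b ?j)"
      by (simp add: power_add)
    show "(if \<not> white m y then on_board m (mode (Suc m) p q) y * on_board m (mode (Suc m) p' q') y else 0) =
        complex_of_real ((?a ?i * ?b ?j + (-1) ^ Suc ?i * ?a ?i * ((-1) ^ Suc ?j * ?b ?j)) / 2)"
    proof (cases "white m y")
      case True
      then show ?thesis unfolding e by (simp add: white_def)
    next
      case False
      then have "even (Suc ?i + Suc ?j)" "even (?i + ?j)" by (simp_all add: white_def)
      then show ?thesis using False mode_mult_mode[of "Suc ?i" "Suc ?j" "Suc m" p q p' q']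
        unfolding e by (simp add: on_board_def del: of_real_mult)
    qed
  qed
  also have "\<dots> = of_real ((\<Sum>y<m * m. ?a (y div m) * ?b (y mod m) +
      (-1) ^ Suc (y div m) * ?a (y div m) * ((-1) ^ Suc (y mod m) * ?b (y mod m))) / 2)"
    by (simp only: of_real_sum sum_divide_distrib)
  also have "(\<Sum>y<m * m. ?a (y div m) * ?b (y mod m) +
      (-1) ^ Suc (y div m) * ?a (y div m) * ((-1) ^ Suc (y mod m) * ?b (y mod m))) =
    (\<Sum>i<m. \<Sum>j<m. ?a i * ?b j + (-1) ^ Suc i * ?a i * ((-1) ^ Suc j * ?b j))"
    by (rule sum_div_mod)
  also have "\<dots> = (\<Sum>i<m. ?a i) * (\<Sum>j<m. ?b j) + (\<Sum>i<m. (-1) ^ Suc i * ?a i) * (\<Sum>j<m. (-1) ^ Suc j * ?b j)"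
    by (simp only: sum.distrib sum_product)
  also have "(\<Sum>i<m. (-1) ^ Suc i * ?a i) = 0"
    by (rule wave_orthogonal_alternating) (use assms in auto)
  finally have s: "s = of_real ((\<Sum>i<m. ?a i) * (\<Sum>j<m. ?b j) / 2)" by simp
  show "s = 0" if "(p, q) \<noteq> (p', q')"
  proof (cases "p = p'")
    case True
    then have "(\<Sum>j<m. ?b j) = 0" using that assms by (intro wave_orthogonal) auto
    then show ?thesis unfolding s by simp
  next
    case False
    then have "(\<Sum>i<m. ?a i) = 0" using that assms by (intro wave_orthogonal) auto
    then show ?thesis unfolding s by simp
  qed
  show "s \<noteq> 0" if "(p, q) = (p', q')"
  proof -
    have "(\<Sum>i<m. ?a i) > 0" "(\<Sum>j<m. ?b j) > 0"
      using that wave_norm_pos[of p m] wave_norm_pos[of q m] assms by auto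
    then show ?thesis unfolding s of_real_eq_0_iff by auto
  qed
qed

text \<open>
  Let \<open>K\<close> be the Kasteleyn matrix with black rows and white columns. On functions on the black cells,
  \<open>K\<close> times its transpose is minus the square of the full skew-symmetric matrix, so the modes with
  vertical frequency at most \<open>n\<close> are eigenvectors. They form an invertible matrix by orthogonality,
  hence the square of the determinant of \<open>K\<close> is the product of the eigenvalues.
\<close>

lemma A_seq_square:
  assumes "n > 0"
  defines "N \<equiv> Suc (2 * n)"
  shows "(real (A_seq n))\<^sup>2 = (\<Prod>p<n. \<Prod>q<2 * n. (eigval N (Suc p))\<^sup>2 + (eigval N (Suc q))\<^sup>2)"
proof -
  define m where "m = 2 * n"
  define k where "k = 2 * n\<^sup>2"
  have m: "even m" "m > 0" and N: "N = Suc m" using assms by (auto simp: m_def)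
  have k: "k = n * m" by (simp add: k_def m_def power2_eq_square)
  define b where "b r = blacks m ! r" for r
  define w where "w c = whites m ! c" for c
  have len: "length (blacks m) = k" "length (whites m) = k"
    using length_blacks_whites[of n] by (simp_all add: m_def k_def)
  have b: "b r < m * m" "\<not> white m (b r)" if "r < k" for r
    using nth_mem[of r "blacks m"] that len by (auto simp: b_def blacks_def)
  have w: "w c < m * m" "white m (w c)" if "c < k" for c
    using nth_mem[of c "whites m"] that len by (auto simp: w_def whites_def)
  have sum_b: "(\<Sum>r<k. f (b r)) = (\<Sum>y<m * m. if \<not> white m y then f y else 0)" for f :: "nat \<Rightarrow> complex"
    using sum_nth_filter_upt[of f "\<lambda>y. \<not> white m y" "m * m"] len by (simp add: b_def blacks_def)
  have sum_w: "(\<Sum>c<k. f (w c)) = (\<Sum>y<m * m. if white m y then f y else 0)" for f :: "nat \<Rightarrow> complex"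
    using sum_nth_filter_upt[of f "white m" "m * m"] len by (simp add: w_def whites_def)
  define P where "P t = Suc (t div m)" for t
  define Q where "Q t = Suc (t mod m)" for t
  have PQ: "2 * P t < Suc m" "Q t < Suc m" "P t > 0" "Q t > 0" if "t < k" for t
  proof -
    have "t div m < n" using that k by (simp add: less_mult_imp_div_less)
    then show "2 * P t < Suc m" by (simp add: P_def m_def)
    show "Q t < Suc m" using m by (simp add: Q_def)
  qed (simp_all add: P_def Q_def)
  have PQ_inj: "(P s, Q s) = (P t, Q t) \<longleftrightarrow> s = t" for s t
    by (auto simp: P_def Q_def) (metis div_mult_mod_eq)
  define F where "F t = on_board m (mode N (P t) (Q t))" for t
  define F' where "F' t = on_board m (\<lambda>i j. \<i> * (of_real (eigval N (Q t)) + (-1) ^ j * of_real (eigval N (P t))) * mode N (P t) (Q t) i j)" for t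
  define l :: "nat \<Rightarrow> complex" where "l t = (of_real (eigval N (P t)))\<^sup>2 + (of_real (eigval N (Q t)))\<^sup>2" for t
  have apply1: "(\<Sum>y<m * m. kasteleyn m x y * F t y) = F' t x"
    and apply2: "(\<Sum>y<m * m. kasteleyn m x y * F' t y) = - l t * F t x" if "x < m * m" for x t
    unfolding F_def F'_def l_def N using kasteleyn_apply_mode[OF m that, where p = "P t" and q = "Q t"] by simp_all
  have bip: "kasteleyn m x y = (0 :: complex)" if "white m x = white m y" for x y
    using kasteleyn_bipartite[OF m(2) that] .
  define K :: "complex mat" where "K = mat k k (\<lambda>(r, c). kasteleyn m (b r) (w c))"
  define Kt :: "complex mat" where "Kt = mat k k (\<lambda>(c, r). kasteleyn m (b r) (w c))"
  define S :: "complex mat" where "S = mat k k (\<lambda>(r, t). F t (b r))"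
  define St :: "complex mat" where "St = mat k k (\<lambda>(t, r). F t (b r))"
  define L :: "complex mat" where "L = mat k k (\<lambda>(s, t). if s = t then l s else 0)"
  have carrier: "K \<in> carrier_mat k k" "Kt \<in> carrier_mat k k" "S \<in> carrier_mat k k"
    "St \<in> carrier_mat k k" "L \<in> carrier_mat k k"
    by (simp_all add: K_def Kt_def S_def St_def L_def)
  have "Kt = transpose_mat K" "St = transpose_mat S"
    by (auto simp: K_def Kt_def S_def St_def intro!: eq_matI)
  then have det_t: "det Kt = det K" "det St = det S"
    using carrier by (simp_all add: det_transpose)
  have "Kt * S = mat k k (\<lambda>(c, t). - F' t (w c))"
    unfolding Kt_def S_def mult_mat_mat
  proof (rule cong_mat[OF refl refl])
    fix c t assume "c < k" "t < k"
    have "(\<Sum>r<k. kasteleyn m (b r) (w c) * F t (b r)) =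
        (\<Sum>y<m * m. if \<not> white m y then kasteleyn m y (w c) * F t y else 0)"
      by (rule sum_b)
    also have "\<dots> = (\<Sum>y<m * m. - (kasteleyn m (w c) y * F t y))"
    proof (rule sum.cong[OF refl])
      fix y show "(if \<not> white m y then kasteleyn m y (w c) * F t y else 0) = - (kasteleyn m (w c) y * F t y)"
        using bip[of "w c" y] w(2)[OF \<open>c < k\<close>] kasteleyn_skew[of m y "w c", where 'b = complex] by auto
    qed
    also have "\<dots> = - F' t (w c)" using apply1[OF w(1)[OF \<open>c < k\<close>]] by (simp add: sum_negf)
    finally show "(case (c, t) of (i, j) \<Rightarrow> \<Sum>r<k. (case (i, r) of (c, r) \<Rightarrow> kasteleyn m (b r) (w c)) *
        (case (r, j) of (r, t) \<Rightarrow> F t (b r))) = (case (c, t) of (c, t) \<Rightarrow> - F' t (w c))" by simp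
  qed
  then have "K * (Kt * S) = mat k k (\<lambda>(r, c). kasteleyn m (b r) (w c)) * mat k k (\<lambda>(c, t). - F' t (w c))"
    by (simp add: K_def)
  also have "\<dots> = mat k k (\<lambda>(r, t). l t * F t (b r))"
    unfolding mult_mat_mat
  proof (rule cong_mat[OF refl refl])
    fix r t assume "r < k" "t < k"
    have "(\<Sum>c<k. kasteleyn m (b r) (w c) * - F' t (w c)) =
        (\<Sum>y<m * m. if white m y then kasteleyn m (b r) y * - F' t y else 0)"
      by (rule sum_w)
    also have "\<dots> = (\<Sum>y<m * m. - (kasteleyn m (b r) y * F' t y))"
    proof (rule sum.cong[OF refl])
      fix y show "(if white m y then kasteleyn m (b r) y * - F' t y else 0) = - (kasteleyn m (b r) y * F' t y)"
        using bip[of "b r" y] b(2)[OF \<open>r < k\<close>] by auto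
    qed
    also have "\<dots> = l t * F t (b r)" using apply2[OF b(1)[OF \<open>r < k\<close>]] by (simp add: sum_negf)
    finally show "(case (r, t) of (i, j) \<Rightarrow> \<Sum>c<k. (case (i, c) of (r, c) \<Rightarrow> kasteleyn m (b r) (w c)) *
        (case (c, j) of (c, t) \<Rightarrow> - F' t (w c))) = (case (r, t) of (r, t) \<Rightarrow> l t * F t (b r))" by simp
  qed
  also have "\<dots> = S * L"
    unfolding S_def L_def mult_mat_mat by (rule cong_mat[OF refl refl]) (simp add: if_distrib cong: if_cong)
  finally have "det (K * (Kt * S)) = det (S * L)" by simp
  moreover have "det (K * (Kt * S)) = det K * (det Kt * det S)"
    using carrier by (simp add: det_mult[of _ k])
  moreover have "det (S * L) = det S * det L"
    using carrier by (simp add: det_mult[of _ k])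
  moreover have "det L = (\<Prod>t<k. l t)" unfolding L_def by (rule det_mat_diag)
  moreover have "det S \<noteq> 0"
  proof -
    \<comment> \<open>The Gram matrix of the modes is diagonal with nonzero entries.\<close>
    define d where "d t = (\<Sum>y<m * m. if \<not> white m y then F t y * F t y else 0)" for t
    have "St * S = mat k k (\<lambda>(s, t). if s = t then d s else 0)"
      unfolding St_def S_def mult_mat_mat
    proof (rule cong_mat[OF refl refl])
      fix s t assume st: "s < k" "t < k"
      have "(\<Sum>r<k. F s (b r) * F t (b r)) = (\<Sum>y<m * m. if \<not> white m y then F s y * F t y else 0)"
        by (rule sum_b)
      also have "\<dots> = (if s = t then d s else 0)"
      proof (cases "s = t")
        case False
        then have "(P s, Q s) \<noteq> (P t, Q t)" using PQ_inj[of s t] by blast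
        then have "(\<Sum>y<m * m. if \<not> white m y then F s y * F t y else 0) = 0"
          unfolding F_def N using PQ[OF st(1)] PQ[OF st(2)] m(2) by (intro black_mode_inner(1)) auto
        then show ?thesis using False by simp
      next
        case True
        show ?thesis unfolding True d_def by simp
      qed
      finally show "(case (s, t) of (i, j) \<Rightarrow> \<Sum>r<k. (case (i, r) of (t, r) \<Rightarrow> F t (b r)) *
          (case (r, j) of (r, t) \<Rightarrow> F t (b r))) = (case (s, t) of (s, t) \<Rightarrow> if s = t then d s else 0)" by simp
    qed
    then have "det St * det S = (\<Prod>t<k. d t)"
      using det_mult[OF carrier(4,3)] det_mat_diag[of k d] by simp
    moreover have "d t \<noteq> 0" if "t < k" for t
      unfolding d_def F_def N using PQ[OF that] m(2) by (intro black_mode_inner(2)) auto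
    ultimately show ?thesis by auto
  qed
  ultimately have "det K * det K = (\<Prod>t<k. l t)" using det_t by (simp add: mult_ac)
  moreover have "K = submat (kasteleyn (2 * n)) (blacks (2 * n)) (whites (2 * n))"
    using len by (simp add: K_def submat_def b_def w_def m_def)
  ultimately have "complex_of_real ((real (A_seq n))\<^sup>2) = (\<Prod>t<k. l t)"
    using A_seq_square_eq_det[OF assms(1), where 'b = complex] by (simp add: power2_eq_square)
  also have "\<dots> = complex_of_real (\<Prod>t<k. (eigval N (P t))\<^sup>2 + (eigval N (Q t))\<^sup>2)"
    by (simp add: l_def)
  finally have "(real (A_seq n))\<^sup>2 = (\<Prod>t<k. (eigval N (P t))\<^sup>2 + (eigval N (Q t))\<^sup>2)"
    by (simp only: of_real_eq_iff)
  also have "\<dots> = (\<Prod>p<n. \<Prod>q<m. (eigval N (Suc p))\<^sup>2 + (eigval N (Suc q))\<^sup>2)"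
    unfolding k P_def Q_def by (rule prod_div_mod)
  finally show ?thesis by (simp add: m_def)
qed

section \<open>From sums to products of cosines\<close>

text \<open>
  The characteristic polynomial of the path with \<open>n\<close> vertices and a loop of weight \<open>-1\<close> at one end.
\<close>

fun chi :: "nat \<Rightarrow> 'a :: comm_ring_1 poly" where
  "chi 0 = 1"
| "chi (Suc 0) = [:1, 1:]"
| "chi (Suc (Suc n)) = [:0, 1:] * chi (Suc n) - chi n"

definition alpha :: "nat \<Rightarrow> nat \<Rightarrow> real" where
  "alpha N a = 2 * cos (2 * pi * real a / real N)"

lemma monic_chi: "degree (chi n :: 'a :: idom poly) = n \<and> coeff (chi n :: 'a poly) n = 1"
proof (induction n rule: chi.induct)
  case (3 n)
  have d: "degree ([:0, 1:] * chi (Suc n) :: 'a poly) = Suc (Suc n)" (is "degree ?p = _")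
    using 3 by (subst degree_mult_eq) auto
  have "degree (chi n :: 'a poly) < degree ?p" unfolding d using 3 by simp
  then have "degree (?p - chi n) = degree ?p"
    by (metis degree_add_eq_left degree_minus diff_conv_add_uminus)
  moreover have "coeff (chi n :: 'a poly) (Suc (Suc n)) = 0" using 3 by (intro coeff_eq_0) simp
  ultimately show ?case using 3 d by simp
qed auto

text \<open>
  The signs are arranged such that the two terms of the recursion add up by Pascal's rule.
\<close>

lemma coeff_chi:
  "coeff (chi n :: 'a :: comm_ring_1 poly) k = (-1) ^ ((n + 3 * k) div 2) * of_nat ((n + k) div 2 choose k)"
proof (induction n arbitrary: k rule: chi.induct)
  case 1
  show ?case
  proof (cases k)
    case (Suc k')
    have "(0 + k) div 2 choose k = 0" by (rule binomial_eq_0) (use Suc in simp)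
    then show ?thesis by (simp only:) (simp add: Suc)
  qed simp
next
  case 2
  consider "k = 0" | "k = 1" | k' where "k = Suc (Suc k')"
    by (metis One_nat_def old.nat.exhaust)
  then show ?case
  proof cases
    case 3
    have "(Suc 0 + k) div 2 choose k = 0" by (rule binomial_eq_0) (use 3 in simp)
    then show ?thesis by (simp only: chi.simps) (simp add: 3 coeff_pCons)
  qed simp_all
next
  case (3 n)
  show ?case
  proof (cases k)
    case 0
    have "(Suc (Suc n) + 3 * 0) div 2 = Suc ((n + 3 * 0) div 2)" by simp
    then show ?thesis using 3(2)[of 0] 0 by simp
  next
    case (Suc j)
    have e1: "(Suc (Suc n) + 3 * k) div 2 = Suc (Suc ((Suc n + 3 * j) div 2))" unfolding Suc by presburger
    have e2: "(Suc (Suc n) + 3 * k) div 2 = Suc ((n + 3 * k) div 2)" by presburger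
    have c: "(Suc (Suc n) + k) div 2 = Suc ((n + k) div 2)" "(Suc n + j) div 2 = (n + k) div 2"
      unfolding Suc by presburger+
    have "coeff (chi (Suc (Suc n)) :: 'a poly) k = coeff (chi (Suc n)) j - coeff (chi n) k"
      by (simp add: Suc)
    also have "\<dots> = (-1) ^ ((Suc (Suc n) + 3 * k) div 2) * of_nat ((Suc n + j) div 2 choose j)
        + (-1) ^ ((Suc (Suc n) + 3 * k) div 2) * of_nat ((n + k) div 2 choose k)"
      unfolding 3 by (subst e1, subst e2) simp
    also have "\<dots> = (-1) ^ ((Suc (Suc n) + 3 * k) div 2) * of_nat ((Suc (Suc n) + k) div 2 choose k)"
      unfolding c Suc by (simp add: algebra_simps)
    finally show ?thesis .
  qed
qed

lemma poly_chi_minus_two: "poly (chi n) (-2 :: 'a :: comm_ring_1) = (-1) ^ n"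
  by (induction n rule: chi.induct) (simp_all add: algebra_simps)

text \<open>
  At \<open>2 * cos t\<close> the polynomial takes the value of the Dirichlet kernel.
\<close>

lemma poly_chi_cos: "poly (chi n) (2 * cos t) * sin (t / 2) = sin (real (2 * n + 1) * (t / 2))"
proof (induction n rule: chi.induct)
  case 2
  have "sin (real (2 * Suc 0 + 1) * (t / 2)) = sin (t + t / 2)" by (simp add: field_simps)
  also have "\<dots> = (2 * cos t + 1) * sin (t / 2)"
  proof -
    have sin: "sin t = 2 * sin (t / 2) * cos (t / 2)" and cos: "2 * (cos (t / 2))\<^sup>2 = 1 + cos t"
      using sin_double[of "t / 2"] cos_double_cos[of "t / 2"] by simp_all
    have "sin t * cos (t / 2) = sin (t / 2) * (2 * (cos (t / 2))\<^sup>2)"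
      unfolding sin by (simp add: power2_eq_square)
    then show ?thesis unfolding sin_add cos by (simp add: algebra_simps)
  qed
  finally show ?case by (simp add: algebra_simps)
next
  case (3 n)
  define s where "s = real (2 * Suc n + 1) * (t / 2)"
  have e: "real (2 * Suc (Suc n) + 1) * (t / 2) = s + t" "real (2 * n + 1) * (t / 2) = s - t"
    by (simp_all add: s_def field_simps)
  have "poly (chi (Suc (Suc n))) (2 * cos t) * sin (t / 2) =
      2 * cos t * (poly (chi (Suc n)) (2 * cos t) * sin (t / 2)) - poly (chi n) (2 * cos t) * sin (t / 2)"
    by (simp add: algebra_simps)
  also have "\<dots> = 2 * cos t * sin s - sin (s - t)"
    unfolding 3 e s_def ..
  also have "\<dots> = sin (s + t)" by (simp add: sin_add sin_diff algebra_simps)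
  finally show ?case unfolding e .
qed simp

lemma alpha_inj_on: "inj_on (alpha (2 * n + 1)) {1..n}"
proof (rule inj_onI)
  fix a b assume ab: "a \<in> {1..n}" "b \<in> {1..n}" and eq: "alpha (2 * n + 1) a = alpha (2 * n + 1) b"
  have "2 * pi * real c / real (2 * n + 1) \<le> pi" if "c \<in> {1..n}" for c
  proof -
    have "2 * real c \<le> real (2 * n + 1)" using that by simp
    from mult_left_mono[OF this, of pi] show ?thesis by (simp add: divide_le_eq mult_ac)
  qed
  with ab have "2 * pi * real a / real (2 * n + 1) = 2 * pi * real b / real (2 * n + 1)"
    using eq unfolding alpha_def by (intro cos_inj_pi[of "2 * pi * real a / real (2 * n + 1)"]) auto
  then show "a = b" by simp
qed

lemma poly_chi_alpha:
  assumes "a \<in> {1..n}"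
  shows "poly (chi n) (alpha (2 * n + 1) a) = 0"
proof -
  define t where "t = 2 * pi * real a / real (2 * n + 1)"
  have "real (2 * n + 1) * (t / 2) = real a * pi" by (simp add: t_def field_simps del: of_nat_Suc)
  then have "poly (chi n) (2 * cos t) * sin (t / 2) = 0"
    unfolding poly_chi_cos by simp
  moreover have "sin (t / 2) > 0"
  proof (rule sin_gt_zero)
    show "0 < t / 2" using assms by (simp add: t_def)
    have "real a < real (2 * n + 1)" using assms by simp
    from mult_strict_left_mono[OF this, of pi] show "t / 2 < pi"
      by (simp add: t_def divide_less_eq mult_ac)
  qed
  ultimately show ?thesis by (simp add: alpha_def t_def)
qed

lemma chi_eq_prod: "chi n = (\<Prod>a\<in>{1..n}. [:- alpha (2 * n + 1) a, 1:])" (is "_ = ?p")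
proof -
  have deg: "degree ?p = n" by (simp add: degree_prod_eq_sum_degree)
  have lead: "lead_coeff ?p = 1" unfolding lead_coeff_prod by simp
  show ?thesis
  proof (rule poly_eqI_degree_lead_coeff)
    show "coeff (chi n) n = coeff ?p n" using monic_chi[of n, where 'a = real] deg lead by simp
    show "n \<le> card (alpha (2 * n + 1) ` {1..n})" by (subst card_image[OF alpha_inj_on]) simp
    show "degree (chi n :: real poly) \<le> n" using monic_chi[of n, where 'a = real] by simp
    show "degree ?p \<le> n" by (simp only: deg)
    fix z assume "z \<in> alpha (2 * n + 1) ` {1..n}"
    then obtain a where a: "a \<in> {1..n}" "z = alpha (2 * n + 1) a" by blast
    have "poly ?p z = 0" unfolding poly_prod using a by (intro prod_zero) auto
    then show "poly (chi n) z = poly ?p z" using poly_chi_alpha[OF a(1)] a(2) by simp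
  qed
qed

text \<open>
  This is the value of \<open>chi n\<close> at \<open>-2\<close>, up to sign.
\<close>

lemma prod_two_plus_alpha: "(\<Prod>a\<in>{1..n}. 2 + alpha (2 * n + 1) a) = 1"
proof -
  have "(-1) ^ n = (\<Prod>a\<in>{1..n}. - 2 - alpha (2 * n + 1) a)"
    using poly_chi_minus_two[of n, where 'a = real] unfolding chi_eq_prod poly_prod by (simp add: algebra_simps)
  also have "\<dots> = (\<Prod>a\<in>{1..n}. (-1) * (2 + alpha (2 * n + 1) a))" by simp
  also have "\<dots> = (-1) ^ n * (\<Prod>a\<in>{1..n}. 2 + alpha (2 * n + 1) a)"
    unfolding prod.distrib by simp
  finally show ?thesis by simp
qed

lemma alpha_reflect:
  assumes "a \<le> N" "N > 0"
  shows "alpha N (N - a) = alpha N a"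
proof -
  have "2 * pi * real (N - a) / real N = 2 * pi - 2 * pi * real a / real N"
    using assms by (simp add: of_nat_diff field_simps)
  then show ?thesis by (simp add: alpha_def)
qed

lemma prod_reflect:
  fixes f :: "nat \<Rightarrow> 'b :: comm_semiring_1"
  assumes "\<And>a. a \<in> {1..n} \<Longrightarrow> f (2 * n + 1 - a) = f a"
  shows "(\<Prod>a\<in>{1..2 * n}. f a) = (\<Prod>a\<in>{1..n}. f a)\<^sup>2"
proof -
  have "(\<Prod>a\<in>{1..2 * n}. f a) = (\<Prod>a\<in>{1..n}. f a) * (\<Prod>a\<in>{n + 1..2 * n}. f a)"
    by (subst prod.union_disjoint[symmetric]) (auto intro!: arg_cong[of _ _ "prod f"])
  also have "(\<Prod>a\<in>{n + 1..2 * n}. f a) = (\<Prod>a\<in>{1..n}. f (2 * n + 1 - a))"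
    by (rule prod.reindex_bij_witness[of _ "\<lambda>a. 2 * n + 1 - a" "\<lambda>a. 2 * n + 1 - a"]) auto
  also have "\<dots> = (\<Prod>a\<in>{1..n}. f a)" using assms by (intro prod.cong) auto
  finally show ?thesis by (simp add: power2_eq_square)
qed

lemma prod_square_triangle:
  fixes h :: "nat \<Rightarrow> nat \<Rightarrow> 'b :: comm_semiring_1"
  assumes "\<And>a b. h a b = h b a"
  shows "(\<Prod>a\<in>{1..n}. \<Prod>b\<in>{1..n}. h a b) = (\<Prod>b\<in>{1..n}. \<Prod>a\<in>{1..<b}. h a b)\<^sup>2 * (\<Prod>a\<in>{1..n}. h a a)"
proof (induction n)
  case (Suc n)
  have "{1..<Suc n} = {1..n}" by auto
  moreover have "(\<Prod>b\<in>{1..n}. h (Suc n) b) = (\<Prod>b\<in>{1..n}. h b (Suc n))"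
    by (intro prod.cong refl assms)
  ultimately show ?case using Suc by (simp add: prod.distrib power2_eq_square mult_ac)
qed simp

text \<open>
  Representatives of the pairs of nonzero residues modulo \<open>2 * n + 1\<close> that are neither equal nor
  opposite.
\<close>

definition off_diagonal :: "nat \<Rightarrow> (nat \<times> nat) set" where
  "off_diagonal n = {(a, b). a \<in> {1..2 * n} \<and> b \<in> {1..2 * n} \<and> a \<noteq> b \<and> a + b \<noteq> 2 * n + 1}"

lemma finite_off_diagonal: "finite (off_diagonal n)"
  by (rule finite_subset[of _ "{1..2 * n} \<times> {1..2 * n}"]) (auto simp: off_diagonal_def)

lemma prod_split_diagonals:
  fixes h :: "nat \<Rightarrow> nat \<Rightarrow> 'b :: comm_semiring_1"
  shows "(\<Prod>a\<in>{1..2 * n}. \<Prod>b\<in>{1..2 * n}. h a b) =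
    (\<Prod>(a, b)\<in>off_diagonal n. h a b) * ((\<Prod>a\<in>{1..2 * n}. h a a) * (\<Prod>a\<in>{1..2 * n}. h a (2 * n + 1 - a)))"
proof -
  let ?U = "{1..2 * n}" and ?H = "\<lambda>(a, b). h a b"
  let ?D1 = "(\<lambda>a. (a, a)) ` ?U" and ?D2 = "(\<lambda>a. (a, 2 * n + 1 - a)) ` ?U"
  have "?U \<times> ?U = off_diagonal n \<union> (?D1 \<union> ?D2)"
    by (auto simp: off_diagonal_def image_iff)
  moreover have "off_diagonal n \<inter> (?D1 \<union> ?D2) = {}" by (auto simp: off_diagonal_def)
  moreover have "?D1 \<inter> ?D2 = {}"
  proof -
    have "a \<noteq> 2 * n + 1 - a" if "a \<in> ?U" for a using that by (auto; presburger)
    then show ?thesis by auto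
  qed
  ultimately have "prod ?H (?U \<times> ?U) = prod ?H (off_diagonal n) * (prod ?H ?D1 * prod ?H ?D2)"
    by (simp add: prod.union_disjoint finite_off_diagonal)
  also have "prod ?H ?D1 = (\<Prod>a\<in>?U. h a a)" by (subst prod.reindex) (auto simp: inj_on_def)
  also have "prod ?H ?D2 = (\<Prod>a\<in>?U. h a (2 * n + 1 - a))" by (subst prod.reindex) (auto simp: inj_on_def)
  finally show ?thesis by (simp add: prod.cartesian_product)
qed

text \<open>
  The map \<open>(a, b) \<mapsto> (a + b, a - b)\<close> on residues modulo \<open>2 * n + 1\<close>.
\<close>

definition rotate_pair :: "nat \<Rightarrow> nat \<times> nat \<Rightarrow> nat \<times> nat" where
  "rotate_pair n = (\<lambda>(a, b). (if a + b < 2 * n + 1 then a + b else a + b - (2 * n + 1),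
                              if a < b then a + (2 * n + 1) - b else a - b))"

lemma rotate_pair_cases:
  assumes "(a, b) \<in> off_diagonal n" "rotate_pair n (a, b) = (s, t)"
  shows "s = a + b \<or> s + (2 * n + 1) = a + b" "t + b = a \<or> t + b = a + (2 * n + 1)"
proof -
  have "s = (if a + b < 2 * n + 1 then a + b else a + b - (2 * n + 1))"
    "t = (if a < b then a + (2 * n + 1) - b else a - b)"
    using assms(2) by (simp_all only: rotate_pair_def prod.case prod.inject)
  moreover have "b \<le> 2 * n" using assms(1) by (simp add: off_diagonal_def)
  ultimately show "s = a + b \<or> s + (2 * n + 1) = a + b" "t + b = a \<or> t + b = a + (2 * n + 1)"
    by (cases "a + b < 2 * n + 1"; simp)+
qed

text \<open>
  The modulus is odd, so the sum and the difference of two residues determine them. They are nonzero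
  since the residues are neither opposite nor equal, and neither equal nor opposite since
  the residues are nonzero.
\<close>

lemma bij_rotate_pair: "bij_betw (rotate_pair n) (off_diagonal n) (off_diagonal n)"
proof -
  have "inj_on (rotate_pair n) (off_diagonal n)"
  proof (rule inj_onI, clarify)
    fix a b c d assume ab: "(a, b) \<in> off_diagonal n" and cd: "(c, d) \<in> off_diagonal n"
      and eq: "rotate_pair n (a, b) = rotate_pair n (c, d)"
    obtain s t where st: "rotate_pair n (a, b) = (s, t)" by (metis surj_pair)
    have bounds: "a \<le> 2 * n" "b \<le> 2 * n" "c \<le> 2 * n" "d \<le> 2 * n"
      using ab cd by (simp_all add: off_diagonal_def)
    \<comment> \<open>Adding the two coordinates shows that \<open>2 * a\<close> and \<open>2 * c\<close> differ by a multiple of the odd modulus.\<close>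
    have "a = c"
    proof -
      let ?N = "2 * n + 1"
      have "\<exists>e\<le>1. s + e * ?N = x + y" "\<exists>e\<le>1. t + y = x + e * ?N"
        if "(x, y) \<in> off_diagonal n" "rotate_pair n (x, y) = (s, t)" for x y
        using rotate_pair_cases[OF that] by (elim disjE; force)+
      from this[OF ab st] this[OF cd st[unfolded eq]] obtain e f e' f'
        where e: "e \<le> 1" "f \<le> 1" "e' \<le> 1" "f' \<le> 1" "s + e * ?N = a + b" "t + b = a + f * ?N"
          "s + e' * ?N = c + d" "t + d = c + f' * ?N" by blast
      then have eq': "2 * a + (f + e') * ?N = 2 * c + (f' + e) * ?N"
        by (simp only: distrib_right)
      then have "even (f + e') \<longleftrightarrow> even (f' + e)"
        by (metis dvd_triv_left even_add even_mult_iff odd_one)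
      then consider "f + e' = f' + e" | "f + e' = 0" "f' + e = 2" | "f + e' = 2" "f' + e = 0"
        using e(1-4) by (auto simp: le_Suc_eq)
      then show "a = c" using eq' bounds by cases simp_all
    qed
    moreover have "b = d"
      using rotate_pair_cases(1)[OF ab st] rotate_pair_cases(1)[OF cd st[unfolded eq]] bounds \<open>a = c\<close>
      by (elim disjE; linarith)
    ultimately show "a = c \<and> b = d" ..
  qed
  moreover have "rotate_pair n z \<in> off_diagonal n" if "z \<in> off_diagonal n" for z
  proof -
    obtain a b s t where z: "z = (a, b)" "rotate_pair n (a, b) = (s, t)" by (metis surj_pair)
    have ab: "(a, b) \<in> off_diagonal n" using that z by simp
    then have "1 \<le> a" "a \<le> 2 * n" "1 \<le> b" "b \<le> 2 * n" "a \<noteq> b" "a + b \<noteq> 2 * n + 1"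
      by (simp_all add: off_diagonal_def)
    note facts = this rotate_pair_cases[OF ab z(2)]
    have "s < 2 * n + 1" "t < 2 * n + 1"
      using z(2) facts(2,4) by (auto simp: rotate_pair_def split: if_splits)
    moreover from facts have "s \<noteq> 0" "t \<noteq> 0" by (elim disjE; linarith)+
    moreover have "s \<noteq> t"
    proof
      assume "s = t"
      then have "2 * b = 0 \<or> 2 * b = 2 * n + 1 \<or> 2 * b = 2 * (2 * n + 1)"
        using rotate_pair_cases[OF ab z(2)] by (elim disjE) simp_all
      then show False using facts(3,4) by presburger
    qed
    moreover have "s + t \<noteq> 2 * n + 1"
    proof
      assume "s + t = 2 * n + 1"
      then have "2 * a = 0 \<or> 2 * a = 2 * n + 1 \<or> 2 * a = 2 * (2 * n + 1)"
        using rotate_pair_cases[OF ab z(2)] by (elim disjE) simp_all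
      then show False using facts(1,2) by presburger
    qed
    ultimately show ?thesis using z by (simp add: off_diagonal_def)
  qed
  ultimately show ?thesis
    by (simp add: bij_betw_def endo_inj_surj finite_off_diagonal image_subset_iff)
qed

lemma alpha_rotate_pair:
  assumes "(a, b) \<in> off_diagonal n" "rotate_pair n (a, b) = (c, d)"
  shows "alpha (2 * n + 1) c + alpha (2 * n + 1) d = alpha (2 * n + 1) a * alpha (2 * n + 1) b"
proof -
  define N where "N = 2 * n + 1"
  define x where "x = 2 * pi * real a / real N"
  define y where "y = 2 * pi * real b / real N"
  have N: "real N > 0" by (simp add: N_def)
  have shift: "2 * pi * u / real N = 2 * pi * v / real N + e * (2 * pi)" if "u = v + e * real N" for u v e
    using N by (simp add: that field_simps)
  have cd: "real c = real a + real b \<or> real c = real a + real b + (-1) * real N"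
    "real d = real a - real b \<or> real d = real a - real b + 1 * real N"
    using rotate_pair_cases[OF assms] unfolding N_def[symmetric] by (auto simp flip: of_nat_add)
  have xy: "2 * pi * (real a + real b) / real N = x + y" "2 * pi * (real a - real b) / real N = x - y"
    by (simp_all add: x_def y_def ring_distribs add_divide_distrib diff_divide_distrib)
  have c: "alpha N c = 2 * cos (x + y)"
    using cd(1)
  proof
    assume "real c = real a + real b + (-1) * real N"
    then show ?thesis unfolding alpha_def by (simp only: shift xy) (simp add: cos_diff)
  qed (simp only: alpha_def xy)
  have d: "alpha N d = 2 * cos (x - y)"
    using cd(2)
  proof
    assume "real d = real a - real b + 1 * real N"
    then show ?thesis unfolding alpha_def by (simp only: shift xy) simp
  qed (simp only: alpha_def xy)
  have "2 * cos (x + y) + 2 * cos (x - y) = (2 * cos x) * (2 * cos y)"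
    by (simp add: cos_add cos_diff)
  then show ?thesis using c d by (simp add: alpha_def x_def y_def N_def)
qed

lemma eigval_square: "(eigval N p)\<^sup>2 = 2 + alpha N p"
proof -
  have "2 * pi * real p / real N = 2 * (real p * pi / real N)" by simp
  then show ?thesis unfolding eigval_def alpha_def by (simp only: cos_double_cos) (simp add: power2_eq_square)
qed

definition pair_product :: "nat \<Rightarrow> real" where
  "pair_product n = (\<Prod>b\<in>{1..n}. \<Prod>a\<in>{1..<b}. 4 + alpha (2 * n + 1) a * alpha (2 * n + 1) b)"

lemma alpha_bounds: "\<bar>alpha N a * alpha N b\<bar> \<le> 4"
proof -
  have "\<bar>alpha N a\<bar> \<le> 2" "\<bar>alpha N b\<bar> \<le> 2" by (simp_all add: alpha_def abs_mult)
  then have "\<bar>alpha N a\<bar> * \<bar>alpha N b\<bar> \<le> 2 * 2" by (intro mult_mono) auto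
  then show ?thesis by (simp add: abs_mult)
qed

text \<open>
  Extended to all pairs of nonzero residues modulo \<open>2 * n + 1\<close>, the product formula gives the fourth
  power of the number of tilings. The equal and the opposite pairs contribute \<open>2 ^ (2 * n)\<close> each, by
  \<open>prod_two_plus_alpha\<close>. On the other pairs the rotation turns sums into products, and there the
  factor of a pair \<open>a < b \<le> n\<close> occurs eight times: two orders and two signs for each entry.
\<close>

lemma B_seq_eq_pair_product:
  assumes "n > 0"
  shows "B_seq n = pair_product n"
proof -
  define N where "N = 2 * n + 1"
  define al where "al = alpha N"
  let ?U = "{1..2 * n}" and ?V = "{1..n}"
  have refl: "al (N - a) = al a" if "a \<le> N" for a
    using alpha_reflect[OF that] by (simp add: al_def N_def)
  have refl': "al (Suc (2 * n) - a) = al a" if "a \<le> Suc (2 * n)" for a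
    using refl[of a] that by (simp add: N_def)
  let ?s = "\<lambda>a b. 4 + al a + al b" and ?p = "\<lambda>a b. 4 + al a * al b"
  have fold: "(\<Prod>a\<in>?U. \<Prod>b\<in>?U. h a b) = (\<Prod>a\<in>?V. \<Prod>b\<in>?U. h a b)\<^sup>2"
    if "\<And>a b. a \<in> ?V \<Longrightarrow> h (N - a) b = h a b" for h :: "nat \<Rightarrow> nat \<Rightarrow> real"
    using that by (intro prod_reflect) (simp add: N_def)
  have "(real (A_seq n))\<^sup>2 = (\<Prod>a\<in>?V. \<Prod>b\<in>?U. ?s a b)"
    using A_seq_square[OF assms]
    by (simp add: eigval_square al_def N_def prod.atLeast1_atMost_eq algebra_simps)
  then have "((real (A_seq n))\<^sup>2)\<^sup>2 = (\<Prod>a\<in>?U. \<Prod>b\<in>?U. ?s a b)"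
    by (subst fold) (simp_all add: refl' N_def)
  also have "\<dots> = (\<Prod>(a, b)\<in>off_diagonal n. ?s a b) *
      ((\<Prod>a\<in>?U. ?s a a) * (\<Prod>a\<in>?U. ?s a (N - a)))"
    unfolding N_def by (rule prod_split_diagonals)
  also have "(\<Prod>a\<in>?U. ?s a (N - a)) = (\<Prod>a\<in>?U. ?s a a)"
    by (intro prod.cong) (auto simp: refl' N_def)
  also have "(\<Prod>a\<in>?U. ?s a a) = (\<Prod>a\<in>?V. ?s a a)\<^sup>2"
    by (intro prod_reflect) (simp add: refl')
  also have "(\<Prod>a\<in>?V. ?s a a) = (\<Prod>a\<in>?V. 2 * (2 + al a))" by (intro prod.cong) auto
  also have "\<dots> = 2 ^ n" unfolding prod.distrib using prod_two_plus_alpha[of n] by (simp add: al_def N_def)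
  also have "(\<Prod>(a, b)\<in>off_diagonal n. ?s a b) = (\<Prod>(a, b)\<in>off_diagonal n. ?p a b)"
  proof -
    have "(\<Prod>(a, b)\<in>off_diagonal n. ?s a b) = (\<Prod>z\<in>off_diagonal n. (\<lambda>(a, b). ?s a b) (rotate_pair n z))"
      by (rule prod.reindex_bij_betw[OF bij_rotate_pair, symmetric])
    also have "\<dots> = (\<Prod>(a, b)\<in>off_diagonal n. ?p a b)"
    proof (rule prod.cong[OF HOL.refl], clarify)
      fix a b assume "(a, b) \<in> off_diagonal n"
      then show "(case rotate_pair n (a, b) of (a, b) \<Rightarrow> ?s a b) = ?p a b"
        using alpha_rotate_pair[of a b n] by (auto simp: al_def N_def split: prod.split)
    qed
    finally show ?thesis .
  qed
  also have "(\<Prod>(a, b)\<in>off_diagonal n. ?p a b) = pair_product n ^ 8"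
  proof -
    \<comment> \<open>The same splitting of all pairs, now with products: the diagonal factors cancel.\<close>
    let ?d = "\<Prod>a\<in>?V. ?p a a"
    have "?d > 0" by (intro prod_pos) (simp add: add_pos_nonneg)
    have "(\<Prod>a\<in>?U. \<Prod>b\<in>?U. ?p a b) = (\<Prod>a\<in>?V. \<Prod>b\<in>?U. ?p a b)\<^sup>2"
      by (rule fold) (simp add: refl' N_def)
    also have "(\<Prod>a\<in>?V. \<Prod>b\<in>?U. ?p a b) = (\<Prod>a\<in>?V. (\<Prod>b\<in>?V. ?p a b)\<^sup>2)"
      by (intro prod.cong[OF HOL.refl] prod_reflect) (simp add: refl')
    also have "\<dots> = (\<Prod>a\<in>?V. \<Prod>b\<in>?V. ?p a b)\<^sup>2" by (simp add: prod_power_distrib)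
    also have "(\<Prod>a\<in>?V. \<Prod>b\<in>?V. ?p a b) = (pair_product n)\<^sup>2 * ?d"
      unfolding pair_product_def N_def[symmetric] al_def[symmetric]
      by (rule prod_square_triangle) (simp add: mult.commute)
    finally have total: "(\<Prod>a\<in>?U. \<Prod>b\<in>?U. ?p a b) = pair_product n ^ 8 * ?d ^ 4"
      by (simp add: power_mult_distrib flip: power_mult)
    have anti: "(\<Prod>a\<in>?U. ?p a (N - a)) = (\<Prod>a\<in>?U. ?p a a)"
      by (intro prod.cong) (auto simp: refl' N_def)
    have diag: "(\<Prod>a\<in>?U. ?p a a) = ?d\<^sup>2"
      by (intro prod_reflect) (simp add: refl')
    have "(\<Prod>a\<in>?U. \<Prod>b\<in>?U. ?p a b) = (\<Prod>(a, b)\<in>off_diagonal n. ?p a b) *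
      ((\<Prod>a\<in>?U. ?p a a) * (\<Prod>a\<in>?U. ?p a (N - a)))"
      unfolding N_def by (rule prod_split_diagonals)
    also have "\<dots> = (\<Prod>(a, b)\<in>off_diagonal n. ?p a b) * ?d ^ 4"
      unfolding anti diag power_add[symmetric] by simp
    finally have "(\<Prod>(a, b)\<in>off_diagonal n. ?p a b) * ?d ^ 4 = pair_product n ^ 8 * ?d ^ 4"
      unfolding total ..
    moreover have "?d ^ 4 \<noteq> 0" using \<open>?d > 0\<close> by (metis less_irrefl power_not_zero)
    ultimately show ?thesis unfolding mult_right_cancel[OF \<open>?d ^ 4 \<noteq> 0\<close>] by simp
  qed
  finally have "real (A_seq n) ^ 4 = (2 ^ n * (pair_product n)\<^sup>2) ^ 4"
    by (simp add: power_mult_distrib mult_ac flip: power_mult power_add)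
  then have A: "real (A_seq n) = 2 ^ n * (pair_product n)\<^sup>2"
    by (subst (asm) power_eq_iff_eq_base) auto
  have "pair_product n \<ge> 0"
    unfolding pair_product_def
  proof (intro prod_nonneg ballI)
    fix a b show "0 \<le> 4 + alpha (2 * n + 1) a * alpha (2 * n + 1) b"
      using alpha_bounds[of "2 * n + 1" a b] by linarith
  qed
  moreover have "pair_product n \<noteq> 0" using A A_seq_pos[of n] by auto
  ultimately show ?thesis using B_seq_unique[OF _ A] by simp
qed

section \<open>Symmetric functions, rationality and integrality\<close>

text \<open>
  The elementary symmetric polynomial of degree \<open>k\<close> in \<open>u 1, \<dots>, u m\<close>, in a form that visibly commutes
  with ring homomorphisms.
\<close>

fun esym :: "(nat \<Rightarrow> 'a :: comm_ring_1) \<Rightarrow> nat \<Rightarrow> nat \<Rightarrow> 'a" where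
  "esym u 0 m = 1"
| "esym u (Suc k) 0 = 0"
| "esym u (Suc k) (Suc m) = esym u (Suc k) m + u (Suc m) * esym u k m"

lemma coeff_prod_linear: "coeff (\<Prod>a\<in>{1..m}. [:1, u a:]) k = esym u k m"
proof (induction m arbitrary: k)
  case 0
  show ?case by (cases k) auto
next
  case (Suc m)
  show ?case
  proof (cases k)
    case 0
    then show ?thesis using Suc[of 0] by (simp add: mult.commute)
  next
    case (Suc j)
    then show ?thesis using Suc.IH[of k] Suc.IH[of j] by (simp add: mult.commute)
  qed
qed

lemma esym_uminus: "esym (\<lambda>a. - u a) k m = (-1) ^ k * esym u k m"
  by (induction u k m rule: esym.induct) (simp_all add: algebra_simps)

lemma prod_one_plus_four:
  fixes u :: "nat \<Rightarrow> 'a :: comm_ring_1"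
  shows "\<exists>z. (\<Prod>a\<in>{1..m}. 1 + 4 * (u a * v)) = 1 + 4 * (v * esym u 1 m) + 16 * (v\<^sup>2 * esym u 2 m) + 64 * z"
proof (induction m)
  case 0
  show ?case by (intro exI[of _ 0]) (simp add: numeral_2_eq_2)
next
  case (Suc m)
  then obtain z where z: "(\<Prod>a\<in>{1..m}. 1 + 4 * (u a * v)) =
      1 + 4 * (v * esym u 1 m) + 16 * (v\<^sup>2 * esym u 2 m) + 64 * z" by blast
  define w where "w = u (Suc m)"
  define A B where "A = esym u 1 m" and "B = esym u 2 m"
  have "(\<Prod>a\<in>{1..Suc m}. 1 + 4 * (u a * v)) = (1 + 4 * (v * A) + 16 * (v\<^sup>2 * B) + 64 * z) * (1 + 4 * (w * v))"
    using z by (simp add: w_def A_def B_def)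
  also have "\<dots> = 1 + 4 * (v * (A + w)) + 16 * (v\<^sup>2 * (B + w * A)) + 64 * (z * (1 + 4 * (w * v)) + v\<^sup>2 * B * (w * v))"
    by (simp add: power2_eq_square algebra_simps)
  also have "A + w = esym u 1 (Suc m)" by (simp add: A_def w_def)
  also have "B + w * A = esym u 2 (Suc m)" by (simp add: A_def B_def w_def numeral_2_eq_2)
  finally show ?case by blast
qed

text \<open>
  The factor of \<open>16\<close> is the second elementary symmetric function of the products \<open>u a * u b\<close> with
  \<open>a < b\<close>; all higher ones come with a multiple of \<open>4 ^ 3\<close>.
\<close>

lemma prod_triangle_one_plus_four:
  fixes u :: "nat \<Rightarrow> 'a :: comm_ring_1"
  shows "\<exists>z. (\<Prod>b\<in>{1..m}. \<Prod>a\<in>{1..<b}. 1 + 4 * (u a * u b)) =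
    1 + 4 * esym u 2 m + 16 * (esym u 1 m * esym u 3 m - esym u 4 m) + 64 * z"
proof (induction m)
  case 0
  show ?case by (intro exI[of _ 0]) (simp add: numeral_2_eq_2 numeral_3_eq_3 eval_nat_numeral)
next
  case (Suc m)
  define v where "v = u (Suc m)"
  define A B C D where "A = esym u 2 m" and "B = esym u 1 m * esym u 3 m - esym u 4 m"
    and "C = v * esym u 1 m" and "D = v\<^sup>2 * esym u 2 m"
  obtain z where z: "(\<Prod>b\<in>{1..m}. \<Prod>a\<in>{1..<b}. 1 + 4 * (u a * u b)) = 1 + 4 * A + 16 * B + 64 * z"
    using Suc unfolding A_def B_def by blast
  obtain z' where z': "(\<Prod>a\<in>{1..m}. 1 + 4 * (u a * v)) = 1 + 4 * C + 16 * D + 64 * z'"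
    using prod_one_plus_four[of u v m] unfolding C_def D_def by blast
  have "{1..<Suc m} = {1..m}" by auto
  then have "(\<Prod>b\<in>{1..Suc m}. \<Prod>a\<in>{1..<b}. 1 + 4 * (u a * u b)) =
      (1 + 4 * A + 16 * B + 64 * z) * (1 + 4 * C + 16 * D + 64 * z')"
    using z z' by (simp add: v_def)
  also have "\<dots> = 1 + 4 * (A + C) + 16 * (B + D + A * C) +
      64 * (z * (1 + 4 * C + 16 * D + 64 * z') + z' * (1 + 4 * A + 16 * B) + A * D + B * C + 4 * (B * D))"
    by (simp add: algebra_simps)
  also have "A + C = esym u 2 (Suc m)"
    by (simp add: A_def C_def v_def numeral_2_eq_2)
  also have "B + D + A * C = esym u 1 (Suc m) * esym u 3 (Suc m) - esym u 4 (Suc m)"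
  proof -
    have "esym u 1 (Suc m) = esym u 1 m + v" "esym u 3 (Suc m) = esym u 3 m + v * esym u 2 m"
      "esym u 4 (Suc m) = esym u 4 m + v * esym u 3 m"
      by (simp_all add: v_def eval_nat_numeral)
    then show ?thesis by (simp only: A_def B_def C_def D_def) (simp add: power2_eq_square algebra_simps)
  qed
  finally show ?case by blast
qed

lemma prod_triangle_mult:
  fixes u :: "nat \<Rightarrow> 'a :: comm_monoid_mult"
  shows "(\<Prod>b\<in>{1..m}. \<Prod>a\<in>{1..<b}. u a * u b) = (\<Prod>a\<in>{1..m}. u a) ^ (m - 1)"
proof (induction m)
  case (Suc m)
  let ?X = "\<Prod>a\<in>{1..m}. u a"
  have "{1..<Suc m} = {1..m}" by auto
  then have "(\<Prod>a\<in>{1..<Suc m}. u a * u (Suc m)) = ?X * u (Suc m) ^ m"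
    by (simp add: prod.distrib)
  then have "(\<Prod>b\<in>{1..Suc m}. \<Prod>a\<in>{1..<b}. u a * u b) = ?X ^ (m - 1) * (?X * u (Suc m) ^ m)"
    using Suc by simp
  also have "\<dots> = (?X * u (Suc m)) ^ m"
    by (cases m) (simp_all add: power_mult_distrib mult_ac)
  finally show ?case by simp
qed simp

text \<open>
  Newton's identities: compare coefficients in \<open>X * P' = P * (\<Sum>i\<in>I. y i * X / (1 + y i * X))\<close>.
\<close>

lemma newton_identity:
  fixes y :: "'i \<Rightarrow> 'a :: field_char_0"
  assumes "finite I"
  defines "P \<equiv> (\<Prod>i\<in>I. [:1, y i:])"
  shows "of_nat k * coeff P k = - (\<Sum>j<k. coeff P j * (\<Sum>i\<in>I. (- y i) ^ (k - j)))"
proof -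
  define q where "q i = Abs_fps (\<lambda>k. if k = 0 then 0 else - ((- y i) ^ k))" for i
  have q: "(1 + fps_const (y i) * fps_X) * q i = fps_const (y i) * fps_X" for i
  proof (rule fps_ext)
    fix k show "fps_nth ((1 + fps_const (y i) * fps_X) * q i) k = fps_nth (fps_const (y i) * fps_X) k"
      by (cases k) (auto simp: q_def distrib_right mult.assoc)
  qed
  define F where "F J = (\<Prod>i\<in>J. 1 + fps_const (y i) * fps_X)" for J
  have "fps_X * fps_deriv (F I) = F I * (\<Sum>i\<in>I. q i)"
    using assms(1)
  proof (induction I rule: finite_induct)
    case (insert i J)
    let ?g = "1 + fps_const (y i) * fps_X"
    have "fps_X * fps_deriv (F (insert i J)) = (fps_const (y i) * fps_X) * F J + ?g * (fps_X * fps_deriv (F J))"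
      using insert(1,2) by (simp add: F_def algebra_simps)
    also have "\<dots> = (?g * q i) * F J + ?g * (F J * (\<Sum>i\<in>J. q i))"
      unfolding q insert(3) ..
    also have "\<dots> = F (insert i J) * (\<Sum>i\<in>insert i J. q i)"
      using insert(1,2) by (simp add: F_def algebra_simps)
    finally show ?case .
  qed (simp add: F_def)
  moreover have "F I = fps_of_poly P"
    by (simp add: F_def P_def fps_of_poly_prod fps_of_poly_pCons mult.commute)
  ultimately have "fps_nth (fps_X * fps_deriv (fps_of_poly P)) k = fps_nth (fps_of_poly P * (\<Sum>i\<in>I. q i)) k"
    by simp
  moreover have "fps_nth (fps_X * fps_deriv (fps_of_poly P)) k = of_nat k * coeff P k"
    by (cases k) auto
  moreover have "fps_nth (fps_of_poly P * (\<Sum>i\<in>I. q i)) k = (\<Sum>j\<le>k. coeff P j * (\<Sum>i\<in>I. fps_nth (q i) (k - j)))"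
    by (simp add: fps_mult_nth fps_sum_nth atLeast0AtMost)
  moreover have "\<dots> = (\<Sum>j<k. coeff P j * (\<Sum>i\<in>I. fps_nth (q i) (k - j)))"
    by (simp add: q_def flip: lessThan_Suc_atMost)
  moreover have "\<dots> = (\<Sum>j<k. - (coeff P j * (\<Sum>i\<in>I. (- y i) ^ (k - j))))"
    by (intro sum.cong) (auto simp: q_def sum_negf)
  ultimately show ?thesis by (simp add: sum_negf)
qed

lemma Rats_sum: "(\<And>i. i \<in> I \<Longrightarrow> f i \<in> \<rat>) \<Longrightarrow> sum f I \<in> \<rat>"
  by (induction I rule: infinite_finite_induct) auto

lemma rational_coeffs_of_power_sums:
  fixes y :: "'i \<Rightarrow> 'a :: field_char_0"
  assumes "finite I" and ps: "\<And>k. k > 0 \<Longrightarrow> (\<Sum>i\<in>I. y i ^ k) \<in> \<rat>"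
  shows "coeff (\<Prod>i\<in>I. [:1, y i:]) k \<in> \<rat>"
proof (induction k rule: less_induct)
  case (less k)
  let ?P = "\<Prod>i\<in>I. [:1, y i:]"
  show ?case
  proof (cases "k = 0")
    case True
    have "coeff ?P 0 = 1" by (simp add: poly_0_coeff_0[symmetric] poly_prod)
    then show ?thesis using True by simp
  next
    case False
    have rat: "(\<Sum>i\<in>I. (- y i) ^ j) \<in> \<rat>" if "j > 0" for j
    proof -
      have "(\<Sum>i\<in>I. (- y i) ^ j) = (-1) ^ j * (\<Sum>i\<in>I. y i ^ j)"
        by (simp add: sum_distrib_left power_minus[of "y _"])
      then show ?thesis using ps[OF that] by simp
    qed
    have "coeff ?P j * (\<Sum>i\<in>I. (- y i) ^ (k - j)) \<in> \<rat>" if "j < k" for j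
      using less[OF that] rat[of "k - j"] that by (intro Rats_mult) auto
    then have "- (\<Sum>j<k. coeff ?P j * (\<Sum>i\<in>I. (- y i) ^ (k - j))) \<in> \<rat>"
      by (intro Rats_minus_iff[THEN iffD2] Rats_sum) auto
    then have "of_nat k * coeff ?P k \<in> \<rat>" unfolding newton_identity[OF assms(1)] .
    then have "of_nat k * coeff ?P k / of_nat k \<in> \<rat>" by (intro Rats_divide) auto
    then show ?thesis using False by simp
  qed
qed

lemma rational_power_sums_of_coeffs:
  fixes y :: "'i \<Rightarrow> 'a :: field_char_0"
  assumes "finite I" and co: "\<And>k. coeff (\<Prod>i\<in>I. [:1, y i:]) k \<in> \<rat>" and "k > 0"
  shows "(\<Sum>i\<in>I. y i ^ k) \<in> \<rat>"
proof -
  let ?P = "\<Prod>i\<in>I. [:1, y i:]" and ?s = "\<lambda>j. \<Sum>i\<in>I. (- y i) ^ j"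
  have P0: "coeff ?P 0 = 1" by (simp add: poly_0_coeff_0[symmetric] poly_prod)
  have "?s k \<in> \<rat>" if "k > 0" for k
    using that
  proof (induction k rule: less_induct)
    case (less k)
    have "{..<k} = insert 0 {1..<k}" using less(2) by auto
    then have "(\<Sum>j<k. coeff ?P j * ?s (k - j)) = ?s k + (\<Sum>j\<in>{1..<k}. coeff ?P j * ?s (k - j))"
      by (simp add: P0)
    then have "of_nat k * coeff ?P k = - (?s k + (\<Sum>j\<in>{1..<k}. coeff ?P j * ?s (k - j)))"
      using newton_identity[OF assms(1), of k y] by (simp only:)
    then have "?s k = - (of_nat k * coeff ?P k) - (\<Sum>j\<in>{1..<k}. coeff ?P j * ?s (k - j))"
      by (simp only:) simp
    also have "\<dots> \<in> \<rat>"
    proof -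
      have "coeff ?P j * ?s (k - j) \<in> \<rat>" if "j \<in> {1..<k}" for j
        using less(1)[of "k - j"] co[of j] that by (intro Rats_mult) auto
      then show ?thesis
        using co by (intro Rats_diff Rats_minus_iff[THEN iffD2] Rats_mult[of "of_nat k"] Rats_sum) auto
    qed
    finally show ?case .
  qed
  moreover have "(\<Sum>i\<in>I. y i ^ k) = (-1) ^ k * ?s k"
    by (simp add: sum_distrib_left power_minus[of "y _"])
  ultimately show ?thesis using assms(3) by simp
qed

lemma sum_square_triangle:
  fixes h :: "nat \<Rightarrow> nat \<Rightarrow> 'b :: comm_semiring_1"
  assumes "\<And>a b. h a b = h b a"
  shows "(\<Sum>a\<in>{1..n}. \<Sum>b\<in>{1..n}. h a b) = 2 * (\<Sum>b\<in>{1..n}. \<Sum>a\<in>{1..<b}. h a b) + (\<Sum>a\<in>{1..n}. h a a)"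
proof (induction n)
  case (Suc n)
  have "{1..<Suc n} = {1..n}" by auto
  moreover have "(\<Sum>b\<in>{1..n}. h (Suc n) b) = (\<Sum>b\<in>{1..n}. h b (Suc n))"
    by (intro sum.cong refl assms)
  ultimately show ?case using Suc by (simp add: sum.distrib algebra_simps mult_2)
qed simp

lemma reflect_linear: "reflect_poly [:- x, 1:] = [:1, - x:]" for x :: real
  by (cases "x = 0") (simp_all add: reflect_poly_def)

lemma alpha_power_sum_rational:
  assumes "k > 0"
  shows "(\<Sum>a\<in>{1..n}. alpha (2 * n + 1) a ^ k) \<in> \<rat>"
proof -
  have "(\<Sum>a\<in>{1..n}. (- alpha (2 * n + 1) a) ^ k) \<in> \<rat>"
  proof (rule rational_power_sums_of_coeffs)
    fix j
    have "(\<Prod>a\<in>{1..n}. [:1, - alpha (2 * n + 1) a:]) = reflect_poly (chi n)"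
      unfolding chi_eq_prod reflect_poly_prod reflect_linear ..
    moreover have "coeff (chi n :: real poly) i \<in> \<rat>" for i by (simp add: coeff_chi)
    ultimately show "coeff (\<Prod>a\<in>{1..n}. [:1, - alpha (2 * n + 1) a:]) j \<in> \<rat>"
      by (simp add: coeff_reflect_poly)
  qed (use assms in auto)
  moreover have "(\<Sum>a\<in>{1..n}. alpha (2 * n + 1) a ^ k) = (-1) ^ k * (\<Sum>a\<in>{1..n}. (- alpha (2 * n + 1) a) ^ k)"
    by (simp add: sum_distrib_left power_minus[of "alpha _ _"])
  ultimately show ?thesis by simp
qed

text \<open>
  The polynomial \<open>chi n\<close> has rational coefficients, so the power sums of its roots \<open>\<alpha> a\<close> are rational.
  Those of the products \<open>\<alpha> a * \<alpha> b\<close> with \<open>a < b\<close> are polynomials in them, and Newton's identities lead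
  back to a product over the pairs.
\<close>

lemma pair_product_rational: "pair_product n \<in> \<rat>"
proof -
  let ?I = "SIGMA b:{1..n}. {1..<b}"
  let ?al = "alpha (2 * n + 1)"
  \<comment> \<open>Scaled such that \<open>4 + \<alpha> a * \<alpha> b\<close> is \<open>4\<close> times the value at \<open>1\<close> of a linear factor with constant term \<open>1\<close>.\<close>
  define y where "y = (\<lambda>(b, a). ?al a * ?al b / 4)"
  let ?P = "\<Prod>i\<in>?I. [:1, y i:]"
  have "coeff ?P k \<in> \<rat>" for k
  proof (rule rational_coeffs_of_power_sums)
    fix k :: nat assume k: "k > 0"
    have "(\<Sum>i\<in>?I. y i ^ k) = (\<Sum>b\<in>{1..n}. \<Sum>a\<in>{1..<b}. (?al a ^ k * ?al b ^ k) / 4 ^ k)"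
      by (subst sum.Sigma) (auto simp: y_def power_mult_distrib power_divide intro!: sum.cong)
    also have "\<dots> = (\<Sum>b\<in>{1..n}. \<Sum>a\<in>{1..<b}. ?al a ^ k * ?al b ^ k) / 4 ^ k"
      by (simp add: sum_divide_distrib)
    also have "(\<Sum>b\<in>{1..n}. \<Sum>a\<in>{1..<b}. ?al a ^ k * ?al b ^ k) =
        ((\<Sum>a\<in>{1..n}. ?al a ^ k)\<^sup>2 - (\<Sum>a\<in>{1..n}. ?al a ^ (2 * k))) / 2"
      using sum_square_triangle[of "\<lambda>a b. ?al a ^ k * ?al b ^ k" n]
      by (simp add: mult.commute power2_eq_square sum_product flip: power_add mult_2)
    finally show "(\<Sum>i\<in>?I. y i ^ k) \<in> \<rat>"
      using alpha_power_sum_rational[of k n] alpha_power_sum_rational[of "2 * k" n] k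
      by (auto intro!: Rats_divide Rats_diff Rats_power)
  qed auto
  then have "poly ?P 1 \<in> \<rat>" unfolding poly_altdef by (intro Rats_sum) auto
  moreover have "pair_product n = 4 ^ card ?I * poly ?P 1"
  proof -
    have "pair_product n = (\<Prod>i\<in>?I. 4 * (1 + y i))"
      unfolding pair_product_def by (subst prod.Sigma) (auto simp: y_def intro!: prod.cong)
    also have "\<dots> = 4 ^ card ?I * (\<Prod>i\<in>?I. 1 + y i)" by (simp only: prod.distrib prod_constant)
    also have "(\<Prod>i\<in>?I. 1 + y i) = poly ?P 1" by (simp add: poly_prod)
    finally show ?thesis .
  qed
  ultimately show ?thesis by (simp only:) (intro Rats_mult Rats_power, auto)
qed

abbreviation eval_int_poly :: "complex \<Rightarrow> int poly \<Rightarrow> complex" where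
  "eval_int_poly w p \<equiv> poly (map_poly of_int p) w"

text \<open>
  Let \<open>z\<close> be the value of \<open>p\<close> at \<open>w\<close>. Since \<open>w ^ N = 1\<close>, each product of \<open>z\<close> with one of \<open>1, w, \<dots>, w ^ (N - 1)\<close> is an integer
  combination of these powers. So \<open>z\<close> is an eigenvalue of an integer matrix, whose characteristic
  polynomial is monic with integer coefficients.
\<close>

lemma algebraic_int_root_of_unity_poly:
  assumes "w ^ N = 1" "N > 0"
  shows "algebraic_int (eval_int_poly w p)"
proof -
  define z where "z = eval_int_poly w p"
  define M0 :: "int mat" where
    "M0 = mat N N (\<lambda>(i, j). \<Sum>k\<le>degree p. if (k + i) mod N = j then coeff p k else 0)"
  define M :: "complex mat" where "M = map_mat of_int M0"
  define v where "v = vec N (\<lambda>j. w ^ j)"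
  have carrier: "M0 \<in> carrier_mat N N" "M \<in> carrier_mat N N" by (simp_all add: M0_def M_def)
  have red: "w ^ (k mod N) = w ^ k" for k
  proof -
    have "w ^ k = w ^ (k mod N + N * (k div N))" by simp
    also have "\<dots> = w ^ (k mod N)" unfolding power_add power_mult assms(1) by simp
    finally show ?thesis ..
  qed
  have "M *\<^sub>v v = z \<cdot>\<^sub>v v"
  proof (rule eq_vecI)
    fix i assume "i < dim_vec (z \<cdot>\<^sub>v v)"
    then have i: "i < N" by (simp add: v_def)
    have "(M *\<^sub>v v) $ i = (\<Sum>j<N. \<Sum>k\<le>degree p. (if (k + i) mod N = j then of_int (coeff p k) * w ^ j else 0))"
    proof -
      have "(M *\<^sub>v v) $ i = (\<Sum>j<N. of_int (\<Sum>k\<le>degree p. if (k + i) mod N = j then coeff p k else 0) * w ^ j)"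
        using i by (simp add: M_def M0_def v_def scalar_prod_def atLeast0LessThan del: of_int_sum)
      also have "\<dots> = (\<Sum>j<N. \<Sum>k\<le>degree p. (if (k + i) mod N = j then of_int (coeff p k) * w ^ j else 0))"
        unfolding of_int_sum sum_distrib_right by (intro sum.cong refl) auto
      finally show ?thesis .
    qed
    also have "\<dots> = (\<Sum>k\<le>degree p. \<Sum>j<N. (if (k + i) mod N = j then of_int (coeff p k) * w ^ j else 0))"
      by (rule sum.swap)
    also have "\<dots> = (\<Sum>k\<le>degree p. of_int (coeff p k) * w ^ (k + i))"
      using assms(2) by (simp add: red)
    also have "\<dots> = z * w ^ i"
      by (simp add: z_def poly_altdef power_add sum_distrib_left mult_ac degree_map_poly)
    finally show "(M *\<^sub>v v) $ i = (z \<cdot>\<^sub>v v) $ i" using i by (simp add: v_def)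
  qed (simp add: M_def M0_def v_def)
  moreover have "v $ 0 = 1" using assms(2) by (simp add: v_def)
  then have "v \<noteq> 0\<^sub>v N" using assms(2) by auto
  ultimately have "eigenvector M v z"
    unfolding eigenvector_def using carrier by (auto simp: v_def)
  then have "eigenvalue M z" unfolding eigenvalue_def by blast
  then have "poly (char_poly M) z = 0" using eigenvalue_root_char_poly[OF carrier(2)] by simp
  moreover have "char_poly M = map_poly of_int (char_poly M0)"
    unfolding M_def by (rule of_int_hom.char_poly_hom[OF carrier(1)])
  moreover have "lead_coeff (char_poly M) = 1" using degree_monic_char_poly[OF carrier(2)] by simp
  ultimately show ?thesis unfolding z_def[symmetric]
    by (intro algebraic_int.intros[of "char_poly M"]) (auto simp: coeff_map_poly)
qed

lemma root_of_unity_poly_integer: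
  assumes "w ^ N = 1" "N > 0" "eval_int_poly w p \<in> \<rat>"
  obtains z where "eval_int_poly w p = of_int z"
  using rational_algebraic_int_is_int[OF algebraic_int_root_of_unity_poly[OF assms(1,2)] assms(3)]
  by (auto elim: Ints_cases)

section \<open>The congruence modulo 64\<close>

lemma eval_int_poly_simps:
  "eval_int_poly w 0 = 0" "eval_int_poly w 1 = 1" "eval_int_poly w (numeral r) = numeral r"
  "eval_int_poly w (p + q) = eval_int_poly w p + eval_int_poly w q"
  "eval_int_poly w (p - q) = eval_int_poly w p - eval_int_poly w q"
  "eval_int_poly w (p * q) = eval_int_poly w p * eval_int_poly w q"
  "eval_int_poly w (monom 1 k) = w ^ k"
  by (simp_all add: of_int_poly_hom.hom_add of_int_poly_hom.hom_minus of_int_poly_hom.hom_mult of_int_poly_hom.hom_numeral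
      poly_monom map_poly_monom)

lemma eval_int_poly_sum: "eval_int_poly w (sum f I) = (\<Sum>i\<in>I. eval_int_poly w (f i))"
  by (induction I rule: infinite_finite_induct) (simp_all add: eval_int_poly_simps)

lemma eval_int_poly_prod: "eval_int_poly w (prod f I) = (\<Prod>i\<in>I. eval_int_poly w (f i))"
  by (induction I rule: infinite_finite_induct) (simp_all add: eval_int_poly_simps)

lemma eval_int_poly_esym: "eval_int_poly w (esym u k m) = esym (\<lambda>a. eval_int_poly w (u a)) k m"
  by (induction u k m rule: esym.induct) (simp_all only: esym.simps eval_int_poly_simps)

lemma esym_cong:
  assumes "\<And>a. a \<in> {1..m} \<Longrightarrow> u a = v a"
  shows "esym u k m = esym v k m"
  using assms by (induction u k m rule: esym.induct) auto

lemma of_real_esym: "of_real (esym u k m) = esym (\<lambda>a. of_real (u a)) k m"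
  by (induction u k m rule: esym.induct) simp_all

text \<open>
  With \<open>v = w ^ (2 * a)\<close> one has \<open>\<alpha> a * w ^ a = 1 + v\<close>. The inverse of \<open>1 + v\<close> is \<open>1 + v\<^sup>2 + \<dots> + v ^ (2 * n)\<close>, because
  the product is \<open>1 + v + \<dots> + v ^ (2 * n + 1)\<close>, where the first \<open>2 * n + 1\<close> terms sum to \<open>0\<close>.
\<close>

lemma inverse_alpha_in_int_poly:
  assumes "a \<in> {1..n}"
  defines "w \<equiv> cis (2 * pi / real (2 * n + 1))"
  shows "of_real (alpha (2 * n + 1) a) *
    eval_int_poly w (monom 1 a * (\<Sum>i\<le>n. monom 1 (4 * a * i))) = 1"
proof -
  define N where "N = 2 * n + 1"
  have N: "N > 0" by (simp add: N_def)
  have pow: "w ^ k = cis (2 * pi * real k / real N)" for k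
    unfolding w_def N_def by (simp add: DeMoivre mult_ac)
  have wN: "w ^ N = 1" unfolding pow using N by simp
  define v where "v = w ^ (2 * a)"
  have "v ^ N = (w ^ N) ^ (2 * a)" unfolding v_def by (simp only: power_mult[symmetric] mult.commute)
  then have vN: "v ^ N = 1" using wN by simp
  have "v \<noteq> 1"
  proof
    assume "v = 1"
    then have "cis (2 * pi * real (2 * a) / real N) = cis (2 * pi * real 0 / real N)"
      by (simp add: v_def pow)
    moreover have "inj_on (\<lambda>k. cis (2 * pi * real k / real N)) {..<N}"
      using bij_betw_roots_unity[OF N] by (simp add: bij_betw_def)
    ultimately have "2 * a = 0"
      using assms(1) by (elim inj_onD) (auto simp: N_def)
    then show False using assms(1) by simp
  qed
  moreover have "(v - 1) * (\<Sum>k<N. v ^ k) = v ^ N - 1" by (rule power_diff_1_eq[symmetric])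
  ultimately have geo: "(\<Sum>k<N. v ^ k) = 0" using vN by simp
  have "of_real (alpha N a) = w ^ a + w ^ (N - a)"
  proof -
    have "2 * pi * real (N - a) / real N = 2 * pi - 2 * pi * real a / real N"
      using assms(1) N by (simp add: N_def of_nat_diff field_simps)
    then show ?thesis unfolding pow alpha_def by (simp add: complex_eq_iff)
  qed
  moreover have "w ^ (N - a) * w ^ a = 1"
  proof -
    have "w ^ (N - a) * w ^ a = w ^ N" using assms(1) by (simp add: N_def flip: power_add)
    then show ?thesis using wN by simp
  qed
  ultimately have "of_real (alpha N a) * w ^ a = 1 + v"
    by (simp add: distrib_right v_def mult_2 power_add)
  moreover have "(\<Sum>i\<le>n. w ^ (4 * a * i)) = (\<Sum>i\<le>n. v ^ (2 * i))"
    by (simp add: v_def mult.assoc flip: power_mult)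
  moreover have "(1 + v) * (\<Sum>i\<le>n. v ^ (2 * i)) = (\<Sum>k<2 * Suc n. v ^ k)"
  proof -
    have "(1 + v) * (\<Sum>i<m. v ^ (2 * i)) = (\<Sum>k<2 * m. v ^ k)" for m
      by (induction m) (simp_all add: distrib_left distrib_right)
    then show ?thesis by (simp only: lessThan_Suc_atMost[symmetric])
  qed
  moreover have "(\<Sum>k<2 * Suc n. v ^ k) = (\<Sum>k<N. v ^ k) + v ^ N" by (simp add: N_def)
  ultimately show ?thesis
    unfolding N_def[symmetric] eval_int_poly_simps eval_int_poly_sum using geo vN
    by (simp add: mult.assoc[symmetric])
qed

lemma chi_0_eq_prod_alpha: "coeff (chi n) 0 = (-1) ^ n * (\<Prod>a\<in>{1..n}. alpha (2 * n + 1) a)"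
  unfolding chi_eq_prod by (simp add: poly_0_coeff_0[symmetric] poly_prod prod_uminus)

lemma coeff_chi_0_square: "(coeff (chi n) 0 :: real)\<^sup>2 = 1"
  by (simp add: coeff_chi flip: power_mult)

lemma alpha_nonzero:
  assumes "a \<in> {1..n}"
  shows "alpha (2 * n + 1) a \<noteq> 0"
  using inverse_alpha_in_int_poly[OF assms] by (metis mult_zero_left of_real_0 zero_neq_one)

lemma esym_inverse_alpha:
  "esym (\<lambda>a. 1 / alpha (2 * n + 1) a) k n = (-1) ^ k * coeff (chi n) 0 * coeff (chi n) k"
proof -
  let ?al = "alpha (2 * n + 1)"
  have "[:- ?al a, 1:] = Polynomial.smult (- ?al a) [:1, - (1 / ?al a):]" if "a \<in> {1..n}" for a
    using alpha_nonzero[OF that] by simp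
  then have "chi n = (\<Prod>a\<in>{1..n}. Polynomial.smult (- ?al a) [:1, - (1 / ?al a):])"
    unfolding chi_eq_prod by (intro prod.cong) auto
  also have "\<dots> = Polynomial.smult (\<Prod>a\<in>{1..n}. - ?al a) (\<Prod>a\<in>{1..n}. [:1, - (1 / ?al a):])"
    by (rule prod_smult)
  also have "(\<Prod>a\<in>{1..n}. - ?al a) = coeff (chi n) 0"
    unfolding chi_0_eq_prod_alpha by (simp add: prod_uminus)
  finally have "coeff (chi n) k = coeff (chi n) 0 * coeff (\<Prod>a\<in>{1..n}. [:1, - (1 / ?al a):]) k"
    by (metis coeff_smult)
  also have "coeff (\<Prod>a\<in>{1..n}. [:1, - (1 / ?al a):]) k = (-1) ^ k * esym (\<lambda>a. 1 / ?al a) k n"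
    unfolding coeff_prod_linear by (rule esym_uminus)
  finally have "(-1) ^ k * coeff (chi n) 0 * coeff (chi n) k =
      ((-1) ^ k * (-1) ^ k) * (coeff (chi n) 0)\<^sup>2 * esym (\<lambda>a. 1 / ?al a) k n"
    by (simp only: power2_eq_square mult_ac)
  then show ?thesis using coeff_chi_0_square[of n] by (simp flip: power_add)
qed

text \<open>
  The inverses \<open>u a\<close> of the numbers \<open>\<alpha> a\<close> are integer polynomials in a root of unity. Hence the
  expansion of \<open>prod_triangle_one_plus_four\<close>, carried out for integer polynomials, holds for \<open>u\<close> with
  a remainder \<open>64 * z\<close> where \<open>z\<close> is such a polynomial value too. The other terms are rational, so \<open>z\<close>
  is rational and therefore an integer. The sign in front is a power of the product of all \<open>\<alpha> a\<close>.
\<close>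

lemma pair_product_mod_64:
  fixes n :: nat
  defines "c \<equiv> (\<lambda>k. coeff (chi n) k :: int)"
  obtains z :: int where
    "of_int (((-1) ^ n * c 0) ^ (n - 1)) * pair_product n =
       of_int (1 + 4 * (c 0 * c 2) + 16 * (c 1 * c 3 - c 0 * c 4) + 64 * z)"
proof -
  let ?al = "alpha (2 * n + 1)"
  define w where "w = cis (2 * pi / real (2 * n + 1))"
  have w: "w ^ (2 * n + 1) = 1" unfolding w_def by (simp add: DeMoivre del: of_nat_add power_Suc)
  define u where "u a = 1 / ?al a" for a
  define U :: "nat \<Rightarrow> int poly" where "U a = monom 1 a * (\<Sum>i\<le>n. monom 1 (4 * a * i))" for a
  have U: "eval_int_poly w (U a) = of_real (u a)" if "a \<in> {1..n}" for a
    using inverse_alpha_in_int_poly[OF that] alpha_nonzero[OF that]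
    by (simp add: w_def U_def u_def field_simps)
  define W where "W = (\<Prod>b\<in>{1..n}. \<Prod>a\<in>{1..<b}. 1 + 4 * (u a * u b))"
  define d where "d = (-1) ^ n * c 0"
  have cr: "real_of_int (c k) = coeff (chi n) k" for k by (simp add: c_def coeff_chi)
  have d: "real_of_int d = (\<Prod>a\<in>{1..n}. ?al a)"
    unfolding d_def of_int_mult cr chi_0_eq_prod_alpha by (simp flip: power_mult_distrib mult.assoc)
  have d2: "d * d = 1"
    unfolding d_def c_def by (simp add: coeff_chi flip: power_mult_distrib power_add) 
  have "pair_product n = (\<Prod>b\<in>{1..n}. \<Prod>a\<in>{1..<b}. (?al a * ?al b) * (1 + 4 * (u a * u b)))"
    unfolding pair_product_def
  proof (intro prod.cong refl)
    fix a b assume "b \<in> {1..n}" "a \<in> {1..<b}"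
    then have "a \<in> {1..n}" "b \<in> {1..n}" by auto
    then have "?al a \<noteq> 0" "?al b \<noteq> 0" by (auto simp only: dest: alpha_nonzero)
    then show "4 + ?al a * ?al b = (?al a * ?al b) * (1 + 4 * (u a * u b))"
      by (simp add: u_def field_simps)
  qed
  also have "\<dots> = (\<Prod>b\<in>{1..n}. \<Prod>a\<in>{1..<b}. ?al a * ?al b) * W"
  proof -
    have "(\<Prod>b\<in>B. \<Prod>a\<in>A b. f a b * g a b) = (\<Prod>b\<in>B. \<Prod>a\<in>A b. f a b) * (\<Prod>b\<in>B. \<Prod>a\<in>A b. g a b)"
      for A B and f g :: "nat \<Rightarrow> nat \<Rightarrow> real" by (simp add: prod.distrib)
    then show ?thesis unfolding W_def .
  qed
  also have "\<dots> = d ^ (n - 1) * W"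
    unfolding prod_triangle_mult d[symmetric] by simp
  finally have half: "pair_product n = d ^ (n - 1) * W" .
  have "real_of_int (d ^ (n - 1)) * real_of_int (d ^ (n - 1)) = 1"
    using d2 by (simp flip: of_int_mult power_mult_distrib)
  with half have W: "W = d ^ (n - 1) * pair_product n"
    by (simp flip: mult.assoc)
  then have Wrat: "W \<in> \<rat>" using pair_product_rational by (auto intro: Rats_mult)
  have e: "esym u 2 n = c 0 * c 2" "esym u 1 n * esym u 3 n - esym u 4 n = c 1 * c 3 - c 0 * c 4"
  proof -
    have c0: "c 0 * (c 0 * x) = x" for x :: real
      using coeff_chi_0_square[of n] by (simp add: cr power2_eq_square flip: mult.assoc)
    have u: "esym u k n = (-1) ^ k * c 0 * c k" for k
    proof -
      have "u = (\<lambda>a. 1 / ?al a)" by (simp add: u_def fun_eq_iff)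
      then show ?thesis by (simp only: esym_inverse_alpha) (simp add: cr)
    qed
    show "esym u 2 n = c 0 * c 2" unfolding u by simp
    show "esym u 1 n * esym u 3 n - esym u 4 n = c 1 * c 3 - c 0 * c 4"
      unfolding u using c0[of 1] by (simp add: mult_ac)
  qed
  obtain z where "(\<Prod>b\<in>{1..n}. \<Prod>a\<in>{1..<b}. 1 + 4 * (U a * U b)) =
      1 + 4 * esym U 2 n + 16 * (esym U 1 n * esym U 3 n - esym U 4 n) + 64 * z"
    using prod_triangle_one_plus_four[of U n] by blast
  then have "eval_int_poly w (\<Prod>b\<in>{1..n}. \<Prod>a\<in>{1..<b}. 1 + 4 * (U a * U b)) =
      eval_int_poly w (1 + 4 * esym U 2 n + 16 * (esym U 1 n * esym U 3 n - esym U 4 n) + 64 * z)"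
    by simp
  moreover have "eval_int_poly w (\<Prod>b\<in>{1..n}. \<Prod>a\<in>{1..<b}. 1 + 4 * (U a * U b)) = of_real W"
    unfolding eval_int_poly_prod eval_int_poly_simps W_def of_real_prod
    by (intro prod.cong refl) (auto simp: U)
  moreover have "eval_int_poly w (esym U k n) = of_real (esym u k n)" for k
    unfolding eval_int_poly_esym of_real_esym by (rule esym_cong) (rule U)
  ultimately have "complex_of_real W = 1 + 4 * of_real (esym u 2 n) +
      16 * (of_real (esym u 1 n) * of_real (esym u 3 n) - of_real (esym u 4 n)) + 64 * eval_int_poly w z"
    by (simp only: eval_int_poly_simps)
  then have "64 * eval_int_poly w z =
      of_real (W - (1 + 4 * esym u 2 n + 16 * (esym u 1 n * esym u 3 n - esym u 4 n)))"
    by (simp add: algebra_simps)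
  then have "64 * eval_int_poly w z = of_real (W - (1 + 4 * (c 0 * c 2) + 16 * (c 1 * c 3 - c 0 * c 4)))"
    unfolding e by simp
  then have ez: "eval_int_poly w z = of_real ((W - (1 + 4 * (c 0 * c 2) + 16 * (c 1 * c 3 - c 0 * c 4))) / 64)"
    unfolding of_real_divide by (simp only: eq_divide_eq) (simp add: mult.commute)
  have "(W - (1 + 4 * (c 0 * c 2) + 16 * (c 1 * c 3 - c 0 * c 4))) / 64 \<in> \<rat>"
    using Wrat by (intro Rats_divide Rats_diff Rats_add Rats_mult) auto
  then have "eval_int_poly w z \<in> \<rat>" unfolding ez by (rule Rats_complex_of_real_iff[THEN iffD2])
  with w obtain y where "eval_int_poly w z = of_int y"
    by (elim root_of_unity_poly_integer[rotated 2]) auto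
  then have "(W - (1 + 4 * (c 0 * c 2) + 16 * (c 1 * c 3 - c 0 * c 4))) / 64 = of_int y"
    unfolding ez by (metis of_real_eq_iff of_real_of_int_eq)
  then have "W = of_int (1 + 4 * (c 0 * c 2) + 16 * (c 1 * c 3 - c 0 * c 4) + 64 * y)"
    by (simp add: field_simps)
  then show ?thesis using that W by (simp add: d_def)
qed

theorem theoremB:
  "(\<forall>l::nat. \<exists>b::int. B_seq (2 * l + 1) = of_int b \<and>
      [b = - 16 * (int l + 1) * int ((l + 2) choose 3) - 16 * int ((l + 2) choose 4)
           - 4 * int ((l + 1) choose 2) + 1] (mod 64)) \<and>
   (\<forall>l::nat. l \<ge> 1 \<longrightarrow> (\<exists>b::int. B_seq (2 * l) = of_int b \<and>
      [(-1) ^ l * b = - 16 * int l * int ((l + 1) choose 3) - 16 * int ((l + 2) choose 4)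
           - 4 * int ((l + 1) choose 2) + 1] (mod 64)))"
proof (intro conjI allI impI)
  fix l :: nat
  let ?n = "2 * l + 1" and ?c = "\<lambda>k. coeff (chi (2 * l + 1)) k :: int"
  let ?s = "(-1) ^ l :: int"
  have "(?n + 3 * 2) div 2 = Suc (Suc (Suc l))" "(?n + 3 * 3) div 2 = Suc (Suc (Suc (Suc (Suc l))))" 
    "(?n + 3 * 4) div 2 = Suc (Suc (Suc (Suc (Suc (Suc l)))))" 
    "(?n + 2) div 2 = l + 1" "(?n + 3) div 2 = l + 2" "(?n + 4) div 2 = l + 2" by presburger+
  then have c: "?c 0 = ?s" "?c 1 = ?s * (int l + 1)" "?c 2 = - ?s * int ((l + 1) choose 2)"
    "?c 3 = - ?s * int ((l + 2) choose 3)" "?c 4 = ?s * int ((l + 2) choose 4)"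
    unfolding coeff_chi by (simp_all add: power_add del: binomial_Suc_Suc)
  have s: "?s * (?s * x) = x" for x by (simp flip: mult.assoc power_add)
  obtain z where z: "of_int (((-1) ^ ?n * ?c 0) ^ (?n - 1)) * pair_product ?n =
     of_int (1 + 4 * (?c 0 * ?c 2) + 16 * (?c 1 * ?c 3 - ?c 0 * ?c 4) + 64 * z)"
    by (rule pair_product_mod_64)
  \<comment> \<open>The exponent \<open>2 * l\<close> is even, so the sign of the product of all \<open>\<alpha> a\<close> disappears.\<close>
  have one: "((-1) ^ ?n * ?c 0) ^ (?n - 1) = 1"
  proof -
    have "?n - 1 = 2 * l" by simp
    then show ?thesis unfolding c
      by (simp only: power_add[symmetric] power_mult[symmetric]) (rule neg_one_even_power, simp)
  qed
  have "pair_product ?n = of_int (1 + 4 * (?c 0 * ?c 2) + 16 * (?c 1 * ?c 3 - ?c 0 * ?c 4) + 64 * z)"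
    using z unfolding one by simp
  also have "1 + 4 * (?c 0 * ?c 2) + 16 * (?c 1 * ?c 3 - ?c 0 * ?c 4) + 64 * z =
      (- 16 * (int l + 1) * int ((l + 2) choose 3) - 16 * int ((l + 2) choose 4)
           - 4 * int ((l + 1) choose 2) + 1) + 64 * z" (is "_ = ?r + _")
    unfolding c using s by (simp add: algebra_simps del: binomial_Suc_Suc)
  finally have half: "pair_product ?n = of_int (?r + 64 * z)" .
  have "B_seq ?n = of_int (?r + 64 * z)"
    unfolding half[symmetric] by (rule B_seq_eq_pair_product) simp
  moreover have "[?r + 64 * z = ?r] (mod 64)" by (simp add: cong_def)
  ultimately show "\<exists>b::int. B_seq ?n = of_int b \<and> [b = ?r] (mod 64)"
    by blast
next
  fix l :: nat assume l: "l \<ge> 1"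
  let ?n = "2 * l" and ?c = "\<lambda>k. coeff (chi (2 * l)) k :: int"
  let ?s = "(-1) ^ l :: int"
  have "(?n + 3 * 1) div 2 = Suc l" "(?n + 3 * 2) div 2 = Suc (Suc (Suc l))" "(?n + 3 * 3) div 2 = Suc (Suc (Suc (Suc l)))" 
    "(?n + 3 * 4) div 2 = Suc (Suc (Suc (Suc (Suc (Suc l)))))" 
    "(?n + 1) div 2 = l" "(?n + 2) div 2 = l + 1" "(?n + 3) div 2 = l + 1" "(?n + 4) div 2 = l + 2" by presburger+
  then have c: "?c 0 = ?s" "?c 1 = - ?s * int l" "?c 2 = - ?s * int ((l + 1) choose 2)"
    "?c 3 = ?s * int ((l + 1) choose 3)" "?c 4 = ?s * int ((l + 2) choose 4)"
    unfolding coeff_chi by (simp_all add: power_add del: binomial_Suc_Suc)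
  have s: "?s * (?s * x) = x" for x by (simp flip: mult.assoc power_add)
  obtain z where z: "of_int (((-1) ^ ?n * ?c 0) ^ (?n - 1)) * pair_product ?n =
     of_int (1 + 4 * (?c 0 * ?c 2) + 16 * (?c 1 * ?c 3 - ?c 0 * ?c 4) + 64 * z)"
    by (rule pair_product_mod_64)
  \<comment> \<open>Here the exponent \<open>2 * l - 1\<close> is odd, and the sign \<open>(-1) ^ l\<close> of the product of all \<open>\<alpha> a\<close> remains.\<close>
  have "((-1) ^ ?n * ?c 0) ^ (?n - 1) = (-1) ^ (l * (2 * l - 1))"
    unfolding c by (simp add: power_mult)
  also have "\<dots> = ?s"
    using l by (intro minus_one_power_eqI) auto
  finally have d: "((-1) ^ ?n * ?c 0) ^ (?n - 1) = ?s" .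
  let ?r = "- 16 * int l * int ((l + 1) choose 3) - 16 * int ((l + 2) choose 4)
           - 4 * int ((l + 1) choose 2) + 1"
  have "of_int ?s * pair_product ?n = of_int (1 + 4 * (?c 0 * ?c 2) + 16 * (?c 1 * ?c 3 - ?c 0 * ?c 4) + 64 * z)"
    using z unfolding d .
  also have "1 + 4 * (?c 0 * ?c 2) + 16 * (?c 1 * ?c 3 - ?c 0 * ?c 4) + 64 * z = ?r + 64 * z"
    unfolding c using s by (simp add: algebra_simps del: binomial_Suc_Suc)
  finally have sh: "of_int ?s * pair_product ?n = of_int (?r + 64 * z)" .
  have "pair_product ?n = (of_int ?s * of_int ?s) * pair_product ?n"
    by (simp flip: power_add)
  also have "\<dots> = of_int (?s * (?r + 64 * z))"
    unfolding mult.assoc sh by (simp only: of_int_mult)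
  finally have half: "pair_product ?n = of_int (?s * (?r + 64 * z))" .
  have "?n > 0" using l by simp
  then have "B_seq ?n = of_int (?s * (?r + 64 * z))"
    unfolding half[symmetric] by (rule B_seq_eq_pair_product)
  moreover have "[?s * (?s * (?r + 64 * z)) = ?r] (mod 64)" unfolding s by (simp add: cong_def)
  ultimately show "\<exists>b::int. B_seq ?n = of_int b \<and> [?s * b = ?r] (mod 64)"
    by blast
qed

end
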